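(* The theory $T^\delta_{\mathrm{PP}}$, consisting of $T^\delta$ together with the axiom scheme (PP), is an axiomatization of $T^\delta_g$.
   Context: Standing assumptions: $\mathbb K$ is a structure in a language $L$ expanding a field of characteristic $0$; $T$ is its complete $L$-theory; $F:=\mathrm{dcl}(\emptyset)$ (a subfield, identified with $\mathrm{dcl}(\emptyset)$ in every model of $T$). $\mathbb K$ is algebraically bounded over $F$: for every $L$-formula $\varphi(\bar x,y)$ there are finitely many $p_1,\dots,p_m\in F[\bar x,y]$ such that, for every tuple $\bar a$ of $\mathbb K$, if $\varphi(\bar a,\mathbb K)$ is finite then it is contained in the zero set of $p_i(\bar a,y)$ for some $i$ with $p_i(\bar a,y)$ not the zero polynomial. In models of $T$, $\mathrm{acl}$ is a matroid with rank $\mathrm{rk}$; for $X\subseteq M^n$ definable with parameters $\bar b$, $\dim(X)=\max\{\mathrm{rk}(\bar a/\bar b):\bar a\in X(\mathbb M)\}$ ($\mathbb M\succ M$ a monster model). $X\subseteq M^n$ is large if $\dim X=n$. A derivation $\eta:F\to F$ is fixed; $L^\delta=L\cup\{\delta\}$ and $T^\delta$ is $T$ plus axioms saying that $\delta$ is a derivation extending $\eta$. In axioms $\mathbb K$ stands for the underlying $L$-structure of an arbitrary model, and $\Pi_n$ is the projection onto the first $n$ coordinates. $T^\delta_g$ is $T^\delta$ plus the scheme: for every $n$ and every $L(\mathbb K)$-definable $W\subseteq\mathbb K^n\times\mathbb K^n$ with $\Pi_n(W)$ large there is $\bar c\in\mathbb K^n$ with $\langle\bar c,\delta\bar c\rangle\in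 W$. (Equivalently, $T^\delta$ plus: for every $L(\mathbb K)$-definable $Z\subseteq\mathbb K^{n+1}$ with $\Pi_n(Z)$ large there is $c$ with $(c,\delta c,\dots,\delta^nc)\in Z$.) For a derivation $\varepsilon$ on $\mathbb K$ and $p\in\mathbb K[\bar x]$, $\bar x=(x_1,\dots,x_n)$, put $p^{[\varepsilon]}(\bar x,\bar y)=p^{\varepsilon}(\bar x)+\sum_{j}\frac{\partial p}{\partial x_j}(\bar x)\,y_j$, where $p^\varepsilon$ is obtained by applying $\varepsilon$ to the coefficients of $p$. For a finite tuple of polynomials $\bar p=(p_1,\dots,p_m)$ let $V_{\mathbb K}(\bar p)=\{\bar c\in\mathbb K^n:p_i(\bar c)=0\ \forall i\}$; for $\bar a\in V_{\mathbb K}(\bar p)$ let $\tau^{\varepsilon}_{\bar a}(\bar p)=\{\bar y\in\mathbb K^n:p_i^{[\varepsilon]}(\bar a,\bar y)=0\ \forall i\}$ ($\varepsilon=0$ gives the usual tangent space), and $\tau^{\varepsilon}(\bar p)=\{\langle\bar a,\bar y\rangle:\bar a\in V_{\mathbb K}(\bar p),\ \bar y\in\tau^{\varepsilon}_{\bar a}(\bar p)\}$. Let $\mathrm{Reg}(\bar p)=\{\bar c\in V_{\mathbb K}(\bar p):\dim(\tau^0_{\bar c}(\bar p))=\dim V_{\mathbb K}(\bar p)\}$. For $m,n,d\in\mathbb N$ let $(\bar p_{m,n,d}(\bar x,\bar a):\bar a\in\mathbb K^\ell)$ be a parametrization, definable in the language of rings, of all $m$-tuples of polynomials in $\mathbb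 K[x_1,\dots,x_n]$ of degree at most $d$. (PP): for all $m,n,d\in\mathbb N$, with $\bar p=\bar p_{m,n,d}$, all $\bar a\in\mathbb K^\ell$ and all $L(\mathbb K)$-definable $X\subseteq\tau^\delta(\bar p(\bar x,\bar a))$: if $\Pi_n(X)\subseteq\mathrm{Reg}(\bar p(\bar x,\bar a))$ and $\dim(\Pi_n(X))=\dim(V_{\mathbb K}(\bar p(\bar x,\bar a)))$, then there is $\bar c\in\mathbb K^n$ with $\langle\bar c,\delta\bar c\rangle\in X$. *)

theory Defs
  imports
    "HOL-Computational_Algebra.Polynomial"
    "HOL-Library.Poly_Mapping"
    "HOL-Library.Equipollence"
begin

section \<open>First-order logic over an expansion of the language of rings\<close>

text \<open>
  A language L expanding the language of rings consists of the ring symbols, which are built into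
  the syntax below, together with further function symbols of type \<open>'f\<close> and relation symbols of
  type \<open>'r\<close>, both with arities.  Hence an L-structure expanding a field is a type of class
  \<^class>\<open>field\<close>, which interprets the ring symbols, with an interpretation of the further symbols.
\<close>

class arity =
  fixes arity :: "'a \<Rightarrow> nat"

datatype 'f tm =
    Var nat
  | Zero
  | One
  | Neg "'f tm"
  | Add "'f tm" "'f tm"
  | Mul "'f tm" "'f tm"
  | Fn 'f "'f tm list"

datatype ('f, 'r) fm =
    Eq "'f tm" "'f tm"
  | Rel 'r "'f tm list"
  | Not "('f, 'r) fm"
  | And "('f, 'r) fm" "('f, 'r) fm"
  | Ex "('f, 'r) fm"

text \<open>
  Variables are de Bruijn indices.  \<open>is_fm k \<phi>\<close>: \<open>\<phi>\<close> respects the arities and its free variables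
  are among the first \<open>k\<close> ones; so \<open>is_fm 0\<close> are the sentences.
\<close>

fun is_tm :: "nat \<Rightarrow> 'f::arity tm \<Rightarrow> bool" where
  "is_tm k (Var i) \<longleftrightarrow> i < k"
| "is_tm k Zero \<longleftrightarrow> True"
| "is_tm k One \<longleftrightarrow> True"
| "is_tm k (Neg t) \<longleftrightarrow> is_tm k t"
| "is_tm k (Add s t) \<longleftrightarrow> is_tm k s \<and> is_tm k t"
| "is_tm k (Mul s t) \<longleftrightarrow> is_tm k s \<and> is_tm k t"
| "is_tm k (Fn f ts) \<longleftrightarrow> length ts = arity f \<and> (\<forall>t\<in>set ts. is_tm k t)"

fun is_fm :: "nat \<Rightarrow> ('f::arity, 'r::arity) fm \<Rightarrow> bool" where
  "is_fm k (Eq s t) \<longleftrightarrow> is_tm k s \<and> is_tm k t"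
| "is_fm k (Rel r ts) \<longleftrightarrow> length ts = arity r \<and> (\<forall>t\<in>set ts. is_tm k t)"
| "is_fm k (Not \<phi>) \<longleftrightarrow> is_fm k \<phi>"
| "is_fm k (And \<phi> \<psi>) \<longleftrightarrow> is_fm k \<phi> \<and> is_fm k \<psi>"
| "is_fm k (Ex \<phi>) \<longleftrightarrow> is_fm (Suc k) \<phi>"

record ('f, 'r, 'a) struc =
  fn_int :: "'f \<Rightarrow> 'a list \<Rightarrow> 'a"
  rel_int :: "'r \<Rightarrow> 'a list \<Rightarrow> bool"

fun eval_tm :: "('f, 'r, 'a::field) struc \<Rightarrow> 'f tm \<Rightarrow> 'a list \<Rightarrow> 'a" where
  "eval_tm M (Var i) e = e ! i"
| "eval_tm M Zero e = 0"
| "eval_tm M One e = 1"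
| "eval_tm M (Neg t) e = - eval_tm M t e"
| "eval_tm M (Add s t) e = eval_tm M s e + eval_tm M t e"
| "eval_tm M (Mul s t) e = eval_tm M s e * eval_tm M t e"
| "eval_tm M (Fn f ts) e = fn_int M f (map (\<lambda>t. eval_tm M t e) ts)"

fun sat :: "('f, 'r, 'a::field) struc \<Rightarrow> ('f, 'r) fm \<Rightarrow> 'a list \<Rightarrow> bool" where
  "sat M (Eq s t) e \<longleftrightarrow> eval_tm M s e = eval_tm M t e"
| "sat M (Rel r ts) e \<longleftrightarrow> rel_int M r (map (\<lambda>t. eval_tm M t e) ts)"
| "sat M (Not \<phi>) e \<longleftrightarrow> \<not> sat M \<phi> e"
| "sat M (And \<phi> \<psi>) e \<longleftrightarrow> sat M \<phi> e \<and> sat M \<psi> e"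
| "sat M (Ex \<phi>) e \<longleftrightarrow> (\<exists>a. sat M \<phi> (a # e))"

definition Th :: "('f::arity, 'r::arity, 'a::field) struc \<Rightarrow> ('f, 'r) fm set" where
  "Th M = {\<phi>. is_fm 0 \<phi> \<and> sat M \<phi> []}"

definition models :: "('f, 'r, 'a::field) struc \<Rightarrow> ('f, 'r) fm set \<Rightarrow> bool" where
  "models M T \<longleftrightarrow> (\<forall>\<phi>\<in>T. sat M \<phi> [])"

text \<open>
  Subsets of \<open>M\<^sup>n\<close> are sets of lists of length \<open>n\<close>; those of \<open>M\<^sup>n \<times> M\<^sup>n\<close> are sets of lists of
  length \<open>2 * n\<close>, with \<open>\<langle>a, b\<rangle>\<close> being \<open>a @ b\<close>.
\<close>

definition def_set ::
  "('f, 'r, 'a::field) struc \<Rightarrow> nat \<Rightarrow> ('f, 'r) fm \<Rightarrow> 'a list \<Rightarrow> 'a list set" where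
  "def_set M n \<phi> bs = {xs. length xs = n \<and> sat M \<phi> (xs @ bs)}"

definition definable ::
  "('f::arity, 'r::arity, 'a::field) struc \<Rightarrow> nat \<Rightarrow> 'a list set \<Rightarrow> bool" where
  "definable M n X \<longleftrightarrow> (\<exists>\<phi> bs. is_fm (n + length bs) \<phi> \<and> X = def_set M n \<phi> bs)"

definition dcl0 :: "('f::arity, 'r::arity, 'a::field) struc \<Rightarrow> 'a set" where
  "dcl0 M = {c. \<exists>\<phi>. is_fm 1 \<phi> \<and> {x. sat M \<phi> [x]} = {c}}"

text \<open>The identification of \<open>dcl(\<emptyset>)\<close> of two elementarily equivalent structures.\<close>

definition dcl0_corr ::
  "('f::arity, 'r::arity, 'a::field) struc \<Rightarrow> ('f, 'r, 'b::field) struc \<Rightarrow> 'a \<Rightarrow> 'b \<Rightarrow> bool" where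
  "dcl0_corr K M c c' \<longleftrightarrow>
     (\<exists>\<phi>. is_fm 1 \<phi> \<and> {x. sat K \<phi> [x]} = {c} \<and> {x. sat M \<phi> [x]} = {c'})"

definition acl :: "('f::arity, 'r::arity, 'a::field) struc \<Rightarrow> 'a set \<Rightarrow> 'a set" where
  "acl M B = {a. \<exists>\<phi> bs. set bs \<subseteq> B \<and> is_fm (Suc (length bs)) \<phi> \<and>
                   finite {x. sat M \<phi> (x # bs)} \<and> sat M \<phi> (a # bs)}"

definition acl_indep ::
  "('f::arity, 'r::arity, 'a::field) struc \<Rightarrow> 'a set \<Rightarrow> 'a set \<Rightarrow> bool" where
  "acl_indep M B A \<longleftrightarrow> (\<forall>a\<in>A. a \<notin> acl M (B \<union> (A - {a})))"

definition rk :: "('f::arity, 'r::arity, 'a::field) struc \<Rightarrow> 'a list \<Rightarrow> 'a list \<Rightarrow> nat" where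
  "rk M as bs = Max {card A | A. A \<subseteq> set as \<and> acl_indep M (set bs) A}"

section \<open>Monster models and dimension\<close>

definition elementary_embedding ::
  "('a \<Rightarrow> 'u) \<Rightarrow> ('f::arity, 'r::arity, 'a::field) struc \<Rightarrow> ('f, 'r, 'u::field) struc \<Rightarrow> bool" where
  "elementary_embedding j M U \<longleftrightarrow>
     (\<forall>\<phi> e. is_fm (length e) \<phi> \<longrightarrow> (sat M \<phi> e \<longleftrightarrow> sat U \<phi> (map j e)))"

text \<open>
  Of the properties of a monster model \<open>U \<succ> M\<close> we only ask for \<open>|M|\<^sup>+\<close>-saturation: every finitely
  satisfiable 1-type over a set of at most \<open>|M|\<close> parameters is realised.
\<close>

definition monster ::
  "('a \<Rightarrow> 'u) \<Rightarrow> ('f::arity, 'r::arity, 'a::field) struc \<Rightarrow> ('f, 'r, 'u::field) struc \<Rightarrow> bool" where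
  "monster j M U \<longleftrightarrow> elementary_embedding j M U \<and>
     (\<forall>A \<Gamma>. A \<lesssim> (UNIV :: 'a set) \<longrightarrow>
        (\<forall>(\<phi>, bs)\<in>\<Gamma>. set bs \<subseteq> A \<and> is_fm (Suc (length bs)) \<phi>) \<longrightarrow>
        (\<forall>\<Gamma>0. finite \<Gamma>0 \<longrightarrow> \<Gamma>0 \<subseteq> \<Gamma> \<longrightarrow> (\<exists>x. \<forall>(\<phi>, bs)\<in>\<Gamma>0. sat U \<phi> (x # bs))) \<longrightarrow>
        (\<exists>x. \<forall>(\<phi>, bs)\<in>\<Gamma>. sat U \<phi> (x # bs)))"

text \<open>
  Dimension is a relation since it is undefined for the empty set (a maximum over no points).
  The definable set \<open>X\<close> does not come with a defining formula; the value does not depend on the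
  choice of \<open>\<phi>\<close> and \<open>bs\<close>.
\<close>

definition has_dim ::
  "('a \<Rightarrow> 'u) \<Rightarrow> ('f::arity, 'r::arity, 'a::field) struc \<Rightarrow> ('f, 'r, 'u::field) struc \<Rightarrow>
   nat \<Rightarrow> 'a list set \<Rightarrow> nat \<Rightarrow> bool" where
  "has_dim j M U n X d \<longleftrightarrow>
     (\<exists>\<phi> bs. is_fm (n + length bs) \<phi> \<and> X = def_set M n \<phi> bs \<and>
        (let R = (\<lambda>as. rk U as (map j bs)) ` def_set U n \<phi> (map j bs)
         in d \<in> R \<and> (\<forall>r\<in>R. r \<le> d)))"

definition large ::
  "('a \<Rightarrow> 'u) \<Rightarrow> ('f::arity, 'r::arity, 'a::field) struc \<Rightarrow> ('f, 'r, 'u::field) struc \<Rightarrow>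
   nat \<Rightarrow> 'a list set \<Rightarrow> bool" where
  "large j M U n X \<longleftrightarrow> has_dim j M U n X n"

section \<open>Polynomials in several variables\<close>

text \<open>An exponent vector is a finitely supported function from variable indices to exponents.\<close>

type_synonym 'a mpol = "(nat \<Rightarrow>\<^sub>0 nat) \<Rightarrow>\<^sub>0 'a"

definition mpol_vars_below :: "nat \<Rightarrow> 'a::zero mpol set" where
  "mpol_vars_below n = {p. \<forall>m\<in>Poly_Mapping.keys p. Poly_Mapping.keys m \<subseteq> {..<n}}"

definition mpol_deg_le :: "nat \<Rightarrow> 'a::zero mpol set" where
  "mpol_deg_le d = {p. \<forall>m\<in>Poly_Mapping.keys p. (\<Sum>i\<in>Poly_Mapping.keys m. Poly_Mapping.lookup m i) \<le> d}"

definition mpol_subst ::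
  "('a \<Rightarrow> 'b) \<Rightarrow> (nat \<Rightarrow> 'b) \<Rightarrow> 'a::zero mpol \<Rightarrow> 'b::comm_ring_1" where
  "mpol_subst c v p = (\<Sum>m\<in>Poly_Mapping.keys p. c (Poly_Mapping.lookup p m) * (\<Prod>i\<in>Poly_Mapping.keys m. v i ^ Poly_Mapping.lookup m i))"

definition mpol_eval :: "'a::comm_ring_1 mpol \<Rightarrow> 'a list \<Rightarrow> 'a" where
  "mpol_eval p xs = mpol_subst (\<lambda>a. a) (\<lambda>i. xs ! i) p"

text \<open>The polynomial \<open>p(a, y)\<close> in the single variable \<open>y\<close>, which is the one following those of \<open>a\<close>.\<close>

definition mpol_fibre :: "'a::comm_ring_1 mpol \<Rightarrow> 'a list \<Rightarrow> 'a poly" where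
  "mpol_fibre p as =
     mpol_subst (\<lambda>a. [:a:]) (\<lambda>i. if i < length as then [:as ! i:] else [:0, 1:]) p"

definition mpol_pderiv :: "nat \<Rightarrow> 'a::comm_ring_1 mpol \<Rightarrow> 'a mpol" where
  "mpol_pderiv i p =
     (\<Sum>m\<in>Poly_Mapping.keys p. Poly_Mapping.single (m - Poly_Mapping.single i 1)
                                     (of_nat (Poly_Mapping.lookup m i) * Poly_Mapping.lookup p m))"

definition mpol_map :: "('a \<Rightarrow> 'a) \<Rightarrow> 'a::comm_ring_1 mpol \<Rightarrow> 'a mpol" where
  "mpol_map \<epsilon> p = (\<Sum>m\<in>Poly_Mapping.keys p. Poly_Mapping.single m (\<epsilon> (Poly_Mapping.lookup p m)))"

definition alg_bounded :: "('f::arity, 'r::arity, 'a::field) struc \<Rightarrow> 'a set \<Rightarrow> bool" where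
  "alg_bounded K F \<longleftrightarrow>
     (\<forall>n \<phi>. is_fm (Suc n) \<phi> \<longrightarrow>
        (\<exists>P. finite P \<and> P \<subseteq> mpol_vars_below (Suc n) \<and> (\<forall>p\<in>P. \<forall>m. Poly_Mapping.lookup p m \<in> F) \<and>
           (\<forall>as. length as = n \<longrightarrow> finite {y. sat K \<phi> (as @ [y])} \<longrightarrow>
              (\<exists>p\<in>P. mpol_fibre p as \<noteq> 0 \<and>
                 {y. sat K \<phi> (as @ [y])} \<subseteq> {y. poly (mpol_fibre p as) y = 0}))))"

section \<open>Derivations and prolongations\<close>

definition derivation_on :: "'a::field set \<Rightarrow> ('a \<Rightarrow> 'a) \<Rightarrow> bool" where
  "derivation_on S \<epsilon> \<longleftrightarrow> \<epsilon> ` S \<subseteq> S \<and>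
     (\<forall>x\<in>S. \<forall>y\<in>S. \<epsilon> (x + y) = \<epsilon> x + \<epsilon> y \<and> \<epsilon> (x * y) = \<epsilon> x * y + x * \<epsilon> y)"

definition prolong :: "('a::field \<Rightarrow> 'a) \<Rightarrow> nat \<Rightarrow> 'a mpol \<Rightarrow> 'a list \<Rightarrow> 'a list \<Rightarrow> 'a" where
  "prolong \<epsilon> n p xs ys =
     mpol_eval (mpol_map \<epsilon> p) xs + (\<Sum>i<n. mpol_eval (mpol_pderiv i p) xs * ys ! i)"

definition zeros :: "nat \<Rightarrow> 'a::field mpol list \<Rightarrow> 'a list set" where
  "zeros n ps = {xs. length xs = n \<and> (\<forall>p\<in>set ps. mpol_eval p xs = 0)}"

definition tau_at :: "('a::field \<Rightarrow> 'a) \<Rightarrow> nat \<Rightarrow> 'a mpol list \<Rightarrow> 'a list \<Rightarrow> 'a list set" where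
  "tau_at \<epsilon> n ps as = {ys. length ys = n \<and> (\<forall>p\<in>set ps. prolong \<epsilon> n p as ys = 0)}"

definition tau :: "('a::field \<Rightarrow> 'a) \<Rightarrow> nat \<Rightarrow> 'a mpol list \<Rightarrow> 'a list set" where
  "tau \<epsilon> n ps = {as @ ys | as ys. as \<in> zeros n ps \<and> ys \<in> tau_at \<epsilon> n ps as}"

definition Reg ::
  "('a \<Rightarrow> 'u) \<Rightarrow> ('f::arity, 'r::arity, 'a::field) struc \<Rightarrow> ('f, 'r, 'u::field) struc \<Rightarrow>
   nat \<Rightarrow> 'a mpol list \<Rightarrow> 'a list set" where
  "Reg j M U n ps = {cs \<in> zeros n ps.
     \<exists>e. has_dim j M U n (tau_at (\<lambda>_. 0) n ps cs) e \<and> has_dim j M U n (zeros n ps) e}"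

section \<open>The theories\<close>

text \<open>
  An \<open>L\<^sup>\<delta>\<close>-structure is an L-structure \<open>M\<close> together with a unary function \<open>\<delta>\<close>.  In what follows
  \<open>K\<close> is the structure whose complete theory is \<open>T\<close>, and \<open>\<eta>\<close> is the given derivation on its
  \<open>dcl(\<emptyset>)\<close>.  The schemes refer to the dimension in \<open>M\<close>, hence to a monster model \<open>U\<close> of \<open>M\<close>.
\<close>

definition model_T_delta ::
  "('f::arity, 'r::arity, 'k::field) struc \<Rightarrow> ('k \<Rightarrow> 'k) \<Rightarrow>
   ('f, 'r, 'a::field) struc \<Rightarrow> ('a \<Rightarrow> 'a) \<Rightarrow> bool" where
  "model_T_delta K \<eta> M \<delta> \<longleftrightarrow> models M (Th K) \<and> derivation_on UNIV \<delta> \<and>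
     (\<forall>c c' d'. c \<in> dcl0 K \<longrightarrow> dcl0_corr K M c c' \<longrightarrow> dcl0_corr K M (\<eta> c) d' \<longrightarrow> \<delta> c' = d')"

definition generic_scheme ::
  "('a \<Rightarrow> 'u) \<Rightarrow> ('f::arity, 'r::arity, 'a::field) struc \<Rightarrow> ('f, 'r, 'u::field) struc \<Rightarrow>
   ('a \<Rightarrow> 'a) \<Rightarrow> bool" where
  "generic_scheme j M U \<delta> \<longleftrightarrow>
     (\<forall>n W. definable M (2 * n) W \<longrightarrow> large j M U n (take n ` W) \<longrightarrow>
        (\<exists>cs. length cs = n \<and> cs @ map \<delta> cs \<in> W))"

text \<open>
  All \<open>m\<close>-tuples of polynomials of degree at most \<open>d\<close> occur in the parametrised family, so
  quantifying over its parameters is quantifying over such tuples.  The two sets whose dimensions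
  are compared are required to have a dimension, i.e. to be nonempty: for \<open>zeros n ps = {}\<close> and
  \<open>X = {}\<close> the conclusion would fail.
\<close>

definition PP_scheme ::
  "('a \<Rightarrow> 'u) \<Rightarrow> ('f::arity, 'r::arity, 'a::field) struc \<Rightarrow> ('f, 'r, 'u::field) struc \<Rightarrow>
   ('a \<Rightarrow> 'a) \<Rightarrow> bool" where
  "PP_scheme j M U \<delta> \<longleftrightarrow>
     (\<forall>m n d ps X. length ps = m \<longrightarrow> set ps \<subseteq> mpol_vars_below n \<inter> mpol_deg_le d \<longrightarrow>
        definable M (2 * n) X \<longrightarrow> X \<subseteq> tau \<delta> n ps \<longrightarrow>
        take n ` X \<subseteq> Reg j M U n ps \<longrightarrow>
        (\<exists>e. has_dim j M U n (take n ` X) e \<and> has_dim j M U n (zeros n ps) e) \<longrightarrow>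
        (\<exists>cs. length cs = n \<and> cs @ map \<delta> cs \<in> X))"

definition model_T_delta_g ::
  "('f::arity, 'r::arity, 'k::field) struc \<Rightarrow> ('k \<Rightarrow> 'k) \<Rightarrow>
   ('a \<Rightarrow> 'u) \<Rightarrow> ('f, 'r, 'a::field) struc \<Rightarrow> ('f, 'r, 'u::field) struc \<Rightarrow> ('a \<Rightarrow> 'a) \<Rightarrow> bool" where
  "model_T_delta_g K \<eta> j M U \<delta> \<longleftrightarrow> model_T_delta K \<eta> M \<delta> \<and> generic_scheme j M U \<delta>"

definition model_T_delta_PP ::
  "('f::arity, 'r::arity, 'k::field) struc \<Rightarrow> ('k \<Rightarrow> 'k) \<Rightarrow>
   ('a \<Rightarrow> 'u) \<Rightarrow> ('f, 'r, 'a::field) struc \<Rightarrow> ('f, 'r, 'u::field) struc \<Rightarrow> ('a \<Rightarrow> 'a) \<Rightarrow> bool" where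
  "model_T_delta_PP K \<eta> j M U \<delta> \<longleftrightarrow> model_T_delta K \<eta> M \<delta> \<and> PP_scheme j M U \<delta>"

end

theory Submission
  imports Defs
begin

text \<open>
  One direction is the prolongation scheme for the empty system of equations.  Then the variety is
  \<open>M\<^sup>n\<close>, its prolongation is \<open>M\<^sup>n \<times> M\<^sup>n\<close>, and all points are regular because \<open>M\<^sup>n\<close> has
  dimension \<open>n\<close> (\<open>PP_imp_generic\<close>).

  For the converse (\<open>generic_imp_PP\<close>) let \<open>X \<subseteq> \<tau>\<^sup>\<delta>(p)\<close> lie over regular points, and let \<open>e\<close> be the
  common dimension of \<open>V(p)\<close> and of the projection \<open>X'\<close> of \<open>X\<close> to the first \<open>n\<close> coordinates.  Some
  coordinate projection \<open>\<pi>\<close> to \<open>M\<^sup>e\<close> maps \<open>X'\<close> onto a large set (\<open>has_dim_projection\<close>).  Genericity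
  in \<open>e\<close> variables gives a point \<open>x \<in> X'\<close> and a point \<open>y\<close> with \<open>\<langle>x, y\<rangle> \<in> X\<close> and \<open>\<pi> y = \<delta> (\<pi> x)\<close>, and the
  question is why \<open>y = \<delta> x\<close>.  Both \<open>y\<close> and \<open>\<delta> x\<close> lie in the affine space \<open>\<tau>\<^sup>\<delta>\<^sub>x(p)\<close>, whose
  associated linear space is \<open>\<tau>\<^sup>0\<^sub>x(p)\<close>, and they have the same image under \<open>\<pi>\<close>.  So it is enough that
  \<open>\<pi>\<close> is injective on \<open>\<tau>\<^sup>0\<^sub>x(p)\<close>.  This space has dimension \<open>e\<close> since \<open>x\<close> is regular, so it is
  enough that \<open>\<pi>\<close> maps \<open>\<tau>\<^sup>\<delta>\<^sub>x(p)\<close> onto \<open>M\<^sup>e\<close>.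

  Surjectivity is obtained from genericity as well, instead of from the extension of derivations to
  algebraic elements: one asks the generic point to satisfy \<open>\<pi> x = x'\<close> and \<open>\<delta> x' \<notin> \<pi>(\<tau>\<^sup>\<delta>\<^sub>x(p))\<close>
  whenever \<open>\<pi>\<close> is not onto for this \<open>x\<close>.  That is contradictory, as \<open>\<delta> x \<in> \<tau>\<^sup>\<delta>\<^sub>x(p)\<close>.  Both requests fit
  into one definable set \<open>W \<subseteq> M\<^sup>e \<times> M\<^sup>e\<close> whose projection to the first \<open>e\<close> coordinates is \<open>\<pi>(X')\<close>.

  What remains is dimension theory: a set that projects onto a large subset of \<open>M\<^sup>k\<close> has dimension
  at least \<open>k\<close>, whatever the defining formulas (\<open>has_dim_ge\<close>).  By saturation, tuples that are
  independent over few parameters can be replaced by tuples of the same type that are independent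
  over all of \<open>M\<close> when the elements are added one after the other (\<open>seq_indep_same_type\<close>).  They are
  generic points for polynomials over \<open>M\<close> (\<open>seq_indep_polyfun_zero\<close>), and algebraic boundedness, which
  passes from \<open>K\<close> to \<open>U\<close> (\<open>alg_bounded_transfer\<close>), makes generic points independent in every order
  (\<open>seq_indep_imp_acl_indep\<close>).
\<close>


section \<open>Formula combinators and renaming of variables\<close>

definition Imp :: "('f, 'r) fm \<Rightarrow> ('f, 'r) fm \<Rightarrow> ('f, 'r) fm" where
  "Imp \<phi> \<psi> = Not (And \<phi> (Not \<psi>))"

definition Forall :: "('f, 'r) fm \<Rightarrow> ('f, 'r) fm" where
  "Forall \<phi> = Not (Ex (Not \<phi>))"

fun ExN :: "nat \<Rightarrow> ('f, 'r) fm \<Rightarrow> ('f, 'r) fm" where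
  "ExN 0 \<phi> = \<phi>"
| "ExN (Suc k) \<phi> = ExN k (Ex \<phi>)"

definition AllN :: "nat \<Rightarrow> ('f, 'r) fm \<Rightarrow> ('f, 'r) fm" where
  "AllN k \<phi> = Not (ExN k (Not \<phi>))"

fun ConjL :: "('f, 'r) fm list \<Rightarrow> ('f, 'r) fm" where
  "ConjL [] = Eq Zero Zero"
| "ConjL (\<phi> # \<phi>s) = And \<phi> (ConjL \<phi>s)"

definition DisjL :: "('f, 'r) fm list \<Rightarrow> ('f, 'r) fm" where
  "DisjL \<phi>s = Not (ConjL (map Not \<phi>s))"

definition eqs :: "nat list \<Rightarrow> nat list \<Rightarrow> ('f, 'r) fm" where
  "eqs is js = ConjL (map2 (\<lambda>i j. Eq (Var i) (Var j)) is js)"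

fun ren_tm :: "(nat \<Rightarrow> nat) \<Rightarrow> 'f tm \<Rightarrow> 'f tm" where
  "ren_tm r (Var i) = Var (r i)"
| "ren_tm r Zero = Zero"
| "ren_tm r One = One"
| "ren_tm r (Neg t) = Neg (ren_tm r t)"
| "ren_tm r (Add s t) = Add (ren_tm r s) (ren_tm r t)"
| "ren_tm r (Mul s t) = Mul (ren_tm r s) (ren_tm r t)"
| "ren_tm r (Fn f ts) = Fn f (map (ren_tm r) ts)"

fun ren_fm :: "(nat \<Rightarrow> nat) \<Rightarrow> ('f, 'r) fm \<Rightarrow> ('f, 'r) fm" where
  "ren_fm r (Eq s t) = Eq (ren_tm r s) (ren_tm r t)"
| "ren_fm r (Rel p ts) = Rel p (map (ren_tm r) ts)"
| "ren_fm r (Not \<phi>) = Not (ren_fm r \<phi>)"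
| "ren_fm r (And \<phi> \<psi>) = And (ren_fm r \<phi>) (ren_fm r \<psi>)"
| "ren_fm r (Ex \<phi>) = Ex (ren_fm (case_nat 0 (\<lambda>i. Suc (r i))) \<phi>)"

text \<open>
  The variables of the renamed formula are positions in a larger environment, so that evaluation
  sees the subtuple picked by the index list (\<open>sat_reindex\<close>).
\<close>

definition reindex :: "nat list \<Rightarrow> ('f, 'r) fm \<Rightarrow> ('f, 'r) fm" where
  "reindex is = ren_fm ((!) is)"

lemma is_tm_mono: "is_tm k t \<Longrightarrow> k \<le> k' \<Longrightarrow> is_tm k' t"
  by (induction t) auto

lemma is_fm_mono: "is_fm k \<phi> \<Longrightarrow> k \<le> k' \<Longrightarrow> is_fm k' \<phi>"
  by (induction \<phi> arbitrary: k k') (auto intro: is_tm_mono)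

lemma eval_ren_tm:
  "is_tm k t \<Longrightarrow> (\<And>i. i < k \<Longrightarrow> e' ! i = e ! r i) \<Longrightarrow> eval_tm A (ren_tm r t) e = eval_tm A t e'"
  by (induction t) (auto intro!: arg_cong[where f = "fn_int A _"])

lemma sat_ren_fm:
  "is_fm k \<phi> \<Longrightarrow> (\<And>i. i < k \<Longrightarrow> e' ! i = e ! r i) \<Longrightarrow> sat A (ren_fm r \<phi>) e \<longleftrightarrow> sat A \<phi> e'"
proof (induction \<phi> arbitrary: k r e e')
  case (Rel p ts)
  then have "map (\<lambda>t. eval_tm A (ren_tm r t) e) ts = map (\<lambda>t. eval_tm A t e') ts"
    by (auto intro!: eval_ren_tm)
  then show ?case by (simp only: ren_fm.simps sat.simps map_map comp_def)
next
  case (Ex \<phi>)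
  have "sat A (ren_fm (case_nat 0 (\<lambda>i. Suc (r i))) \<phi>) (a # e) \<longleftrightarrow> sat A \<phi> (a # e')" for a
    using Ex.prems by (intro Ex.IH[of "Suc k"]) (auto split: nat.split simp: nth_Cons')
  then show ?case by simp
next
  case (Eq s t)
  then show ?case using eval_ren_tm[of k _ e' e r A] by simp
next
  case (And \<phi> \<psi>)
  then show ?case using And.IH[of k e' e r] by simp
next
  case (Not \<phi>)
  then show ?case using Not.IH[of k e' e r] by simp
qed

lemma is_tm_ren: "is_tm k t \<Longrightarrow> (\<And>i. i < k \<Longrightarrow> r i < k') \<Longrightarrow> is_tm k' (ren_tm r t)"
  by (induction t) auto

lemma is_fm_ren: "is_fm k \<phi> \<Longrightarrow> (\<And>i. i < k \<Longrightarrow> r i < k') \<Longrightarrow> is_fm k' (ren_fm r \<phi>)"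
proof (induction \<phi> arbitrary: k k' r)
  case (Ex \<phi>)
  show ?case using Ex.prems
    by simp (rule Ex.IH[of "Suc k"], auto split: nat.split)
qed (auto intro: is_tm_ren)

lemma ren_tm_id: "ren_tm (\<lambda>i. i) t = t"
  by (induction t) (auto intro: map_idI)

lemma ren_fm_id: "ren_fm (\<lambda>i. i) \<phi> = \<phi>"
proof (induction \<phi>)
  case (Ex \<phi>)
  have "(\<lambda>i. case i of 0 \<Rightarrow> 0 | Suc x \<Rightarrow> Suc x) = (\<lambda>i. i)"
    by (auto split: nat.split)
  then show ?case using Ex by simp
qed (auto simp: ren_tm_id intro: map_idI)

lemma sat_append: "is_fm (length e) \<phi> \<Longrightarrow> sat A \<phi> (e @ e') \<longleftrightarrow> sat A \<phi> e"
  using sat_ren_fm[of "length e" \<phi> e "e @ e'" "\<lambda>i. i" A]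
  by (simp add: ren_fm_id nth_append)

lemma sat_reindex:
  "is_fm (length is) \<phi> \<Longrightarrow> sat A (reindex is \<phi>) e \<longleftrightarrow> sat A \<phi> (map ((!) e) is)"
  unfolding reindex_def by (rule sat_ren_fm) auto

lemma is_fm_reindex:
  "is_fm (length is) \<phi> \<Longrightarrow> set is \<subseteq> {..<k} \<Longrightarrow> is_fm k (reindex is \<phi>)"
  unfolding reindex_def by (rule is_fm_ren) (auto simp: subset_iff)

lemma sat_combinators [simp]:
  "sat A (Imp \<phi> \<psi>) e \<longleftrightarrow> (sat A \<phi> e \<longrightarrow> sat A \<psi> e)"
  "sat A (Forall \<phi>) e \<longleftrightarrow> (\<forall>x. sat A \<phi> (x # e))"
  "sat A (ConjL \<phi>s) e \<longleftrightarrow> (\<forall>\<phi>\<in>set \<phi>s. sat A \<phi> e)"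
  "sat A (DisjL \<phi>s) e \<longleftrightarrow> (\<exists>\<phi>\<in>set \<phi>s. sat A \<phi> e)"
proof -
  show conj: "sat A (ConjL \<phi>s) e \<longleftrightarrow> (\<forall>\<phi>\<in>set \<phi>s. sat A \<phi> e)" for \<phi>s
    by (induction \<phi>s) auto
  show "sat A (DisjL \<phi>s) e \<longleftrightarrow> (\<exists>\<phi>\<in>set \<phi>s. sat A \<phi> e)"
    by (simp add: DisjL_def conj)
qed (simp_all add: Imp_def Forall_def)

lemma sat_ExN [simp]: "sat A (ExN k \<phi>) e \<longleftrightarrow> (\<exists>xs. length xs = k \<and> sat A \<phi> (xs @ e))"
proof (induction k arbitrary: \<phi>)
  case (Suc k)
  have "(\<exists>xs. length xs = k \<and> (\<exists>a. sat A \<phi> (a # xs @ e))) \<longleftrightarrow>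
        (\<exists>zs. length zs = Suc k \<and> sat A \<phi> (zs @ e))"
    by (metis append_Cons length_Suc_conv)
  then show ?case by (simp add: Suc.IH)
qed simp

lemma sat_AllN [simp]: "sat A (AllN k \<phi>) e \<longleftrightarrow> (\<forall>xs. length xs = k \<longrightarrow> sat A \<phi> (xs @ e))"
  by (simp add: AllN_def)

lemma sat_eqs [simp]:
  "length is = length js \<Longrightarrow> sat A (eqs is js) e \<longleftrightarrow> map ((!) e) is = map ((!) e) js"
  by (induction "is" js rule: list_induct2) (auto simp: eqs_def)

lemma is_fm_combinators [simp]:
  "is_fm k (Imp \<phi> \<psi>) \<longleftrightarrow> is_fm k \<phi> \<and> is_fm k \<psi>"
  "is_fm k (Forall \<phi>) \<longleftrightarrow> is_fm (Suc k) \<phi>"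
  "is_fm k (ConjL \<phi>s) \<longleftrightarrow> (\<forall>\<phi>\<in>set \<phi>s. is_fm k \<phi>)"
  "is_fm k (DisjL \<phi>s) \<longleftrightarrow> (\<forall>\<phi>\<in>set \<phi>s. is_fm k \<phi>)"
proof -
  show conj: "is_fm k (ConjL \<phi>s) \<longleftrightarrow> (\<forall>\<phi>\<in>set \<phi>s. is_fm k \<phi>)" for \<phi>s
    by (induction \<phi>s) auto
  show "is_fm k (DisjL \<phi>s) \<longleftrightarrow> (\<forall>\<phi>\<in>set \<phi>s. is_fm k \<phi>)"
    by (simp add: DisjL_def conj)
qed (simp_all add: Imp_def Forall_def)

lemma is_fm_ExN [simp]: "is_fm k (ExN l \<phi>) \<longleftrightarrow> is_fm (l + k) \<phi>"
  by (induction l arbitrary: \<phi>) auto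

lemma is_fm_AllN [simp]: "is_fm k (AllN l \<phi>) \<longleftrightarrow> is_fm (l + k) \<phi>"
  by (simp add: AllN_def)

lemma is_fm_eqs: "set is \<subseteq> {..<k} \<Longrightarrow> set js \<subseteq> {..<k} \<Longrightarrow> is_fm k (eqs is js)"
  by (fastforce simp: eqs_def dest: set_zip_leftD set_zip_rightD)

text \<open>
  Finiteness is not first order, but ``at most \<open>N\<close> solutions'' is; this is how finiteness of
  solution sets is moved between structures and between tuples of the same type.
\<close>

definition at_most :: "nat \<Rightarrow> nat \<Rightarrow> ('f, 'r) fm \<Rightarrow> ('f, 'r) fm" where
  "at_most N k \<phi> = ExN N (Forall (Imp (reindex (0 # [Suc N..<Suc N + k]) \<phi>)
                                      (DisjL (map (\<lambda>i. Eq (Var 0) (Var (Suc i))) [0..<N]))))"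

lemma is_fm_at_most: "is_fm (Suc k) \<phi> \<Longrightarrow> is_fm k (at_most N k \<phi>)"
  by (auto simp: at_most_def simp del: upt_Suc intro!: is_fm_reindex)

lemma map_nth_shift: "map ((!) (xs @ ys)) [length xs..<length xs + length ys] = ys"
  by (rule nth_equalityI) auto

lemma map_nth_take: "n \<le> length xs \<Longrightarrow> map ((!) xs) [0..<n] = take n xs"
  by (rule nth_equalityI) auto

lemma sat_at_most:
  assumes "is_fm (Suc k) \<phi>" "length e = k"
  shows "sat A (at_most N k \<phi>) e \<longleftrightarrow>
           finite {y. sat A \<phi> (y # e)} \<and> card {y. sat A \<phi> (y # e)} \<le> N" (is "_ \<longleftrightarrow> finite ?S \<and> _")
proof -
  have 1: "sat A (at_most N k \<phi>) e \<longleftrightarrow> (\<exists>zs. length zs = N \<and> ?S \<subseteq> set zs)"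
  proof -
    have "sat A (reindex (0 # [Suc N..<Suc N + k]) \<phi>) (x # xs @ e) \<longleftrightarrow> sat A \<phi> (x # e)"
      if "length xs = N" for x xs
      using map_nth_shift[of "x # xs" e] that assms by (simp add: sat_reindex del: upt_Suc)
    moreover have "(\<exists>i\<in>{0..<N}. x = (xs @ e) ! i) \<longleftrightarrow> x \<in> set xs" if "length xs = N" for x xs
      using that by (auto simp: in_set_conv_nth nth_append)
    ultimately have "(\<forall>x. sat A (Imp (reindex (0 # [Suc N..<Suc N + k]) \<phi>)
          (DisjL (map (\<lambda>i. Eq (Var 0) (Var (Suc i))) [0..<N]))) (x # xs @ e)) \<longleftrightarrow> ?S \<subseteq> set xs"
      if "length xs = N" for xs
      using that by (auto simp del: upt_Suc)
    then show ?thesis by (auto simp: at_most_def simp del: upt_Suc)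
  qed
  also have "\<dots> \<longleftrightarrow> finite ?S \<and> card ?S \<le> N"
  proof
    assume "\<exists>zs. length zs = N \<and> ?S \<subseteq> set zs"
    then show "finite ?S \<and> card ?S \<le> N"
      by (metis List.finite_set card_length card_mono finite_subset le_trans)
  next
    assume fin: "finite ?S \<and> card ?S \<le> N"
    then obtain xs where xs: "set xs = ?S" "distinct xs"
      using finite_distinct_list by blast
    then have "length xs \<le> N" using fin distinct_card by metis
    then have "length (xs @ replicate (N - length xs) 0) = N" by simp
    moreover have "?S \<subseteq> set (xs @ replicate (N - length xs) 0)" using xs by auto
    ultimately show "\<exists>zs. length zs = N \<and> ?S \<subseteq> set zs" by blast
  qed
  finally show ?thesis .
qed


section \<open>Polynomial functions\<close>

text \<open>
  Functions of tuples instead of formal polynomials: over infinite fields this loses nothing, and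
  substitution becomes composition.  The coefficients come from the ring generated by \<open>L\<close>.  Only
  the values on lists of length \<open>n\<close> matter, hence the rule \<open>cong\<close>.
\<close>

inductive polyfun :: "'a::comm_ring_1 set \<Rightarrow> nat \<Rightarrow> ('a list \<Rightarrow> 'a) \<Rightarrow> bool" for L n where
  const: "c \<in> L \<Longrightarrow> polyfun L n (\<lambda>_. c)"
| zero: "polyfun L n (\<lambda>_. 0)"
| one: "polyfun L n (\<lambda>_. 1)"
| coord: "i < n \<Longrightarrow> polyfun L n (\<lambda>xs. xs ! i)"
| uminus: "polyfun L n f \<Longrightarrow> polyfun L n (\<lambda>xs. - f xs)"
| add: "polyfun L n f \<Longrightarrow> polyfun L n g \<Longrightarrow> polyfun L n (\<lambda>xs. f xs + g xs)"
| mult: "polyfun L n f \<Longrightarrow> polyfun L n g \<Longrightarrow> polyfun L n (\<lambda>xs. f xs * g xs)"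
| cong: "polyfun L n f \<Longrightarrow> (\<And>xs. length xs = n \<Longrightarrow> f xs = g xs) \<Longrightarrow> polyfun L n g"

lemma polyfun_sum: "(\<And>i. i \<in> I \<Longrightarrow> polyfun L n (f i)) \<Longrightarrow> polyfun L n (\<lambda>xs. \<Sum>i\<in>I. f i xs)"
  by (induction I rule: infinite_finite_induct) (auto intro: polyfun.intros)

lemma polyfun_prod: "(\<And>i. i \<in> I \<Longrightarrow> polyfun L n (f i)) \<Longrightarrow> polyfun L n (\<lambda>xs. \<Prod>i\<in>I. f i xs)"
  by (induction I rule: infinite_finite_induct) (auto intro: polyfun.intros)

lemma polyfun_power: "polyfun L n f \<Longrightarrow> polyfun L n (\<lambda>xs. f xs ^ k)"
  by (induction k) (auto intro: polyfun.intros)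

lemma polyfun_mono: "polyfun L n f \<Longrightarrow> L \<subseteq> L' \<Longrightarrow> polyfun L' n f"
  by (induction rule: polyfun.induct) (auto intro: polyfun.intros)

lemma polyfun_comp:
  assumes "polyfun L m f" "length cs = m" "\<And>c. c \<in> set cs \<Longrightarrow> polyfun L n c"
  shows "polyfun L n (\<lambda>xs. f (map (\<lambda>c. c xs) cs))"
  using assms
proof (induction rule: polyfun.induct)
  case (coord i)
  then have "polyfun L n (cs ! i)" by auto
  then show ?case using coord by simp
qed (auto intro: polyfun.intros)

text \<open>
  This is for inductions on the number of arguments: a value \<open>f (x # xs) = 0\<close> makes \<open>x\<close> algebraic
  over \<open>xs\<close> unless all coefficients vanish at \<open>xs\<close>, which are functions of the same kind.
\<close>

lemma polyfun_poly:
  assumes "polyfun L (Suc n) f"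
  shows "\<exists>q. (\<forall>l. polyfun L n (\<lambda>xs. coeff (q xs) l)) \<and>
             (\<forall>x xs. length xs = n \<longrightarrow> f (x # xs) = poly (q xs) x)"
  using assms
proof (induction rule: polyfun.induct)
  case (const c)
  have "polyfun L n (\<lambda>xs. coeff [:c:] l)" for l
    using const by (cases l) (auto intro: polyfun.intros)
  then show ?case by (intro exI[of _ "\<lambda>_. [:c:]"]) simp
next
  case zero
  then show ?case by (intro exI[of _ "\<lambda>_. 0"]) (auto intro: polyfun.intros)
next
  case one
  have "polyfun L n (\<lambda>xs. coeff [:1:] l)" for l
    by (cases l) (auto intro: polyfun.intros)
  then show ?case by (intro exI[of _ "\<lambda>_. [:1:]"]) simp
next
  case (coord i)
  show ?case
  proof (cases i)
    case 0
    have "polyfun L n (\<lambda>xs. coeff [:0, 1:] l)" for l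
      by (auto simp: coeff_pCons split: nat.split intro: polyfun.intros)
    then show ?thesis using 0 by (intro exI[of _ "\<lambda>_. [:0, 1:]"]) simp
  next
    case (Suc k)
    have "polyfun L n (\<lambda>xs. coeff [:xs ! k:] l)" for l
      using coord Suc by (cases l) (auto intro: polyfun.intros)
    then show ?thesis using Suc by (intro exI[of _ "\<lambda>xs. [:xs ! k:]"]) simp
  qed
next
  case (uminus f)
  then obtain q where "\<forall>l. polyfun L n (\<lambda>xs. coeff (q xs) l)"
    "\<forall>x xs. length xs = n \<longrightarrow> f (x # xs) = poly (q xs) x" by blast
  then show ?case by (intro exI[of _ "\<lambda>xs. - q xs"]) (auto intro: polyfun.intros)
next
  case (add f g)
  then obtain q r where "\<forall>l. polyfun L n (\<lambda>xs. coeff (q xs) l)"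
    "\<forall>x xs. length xs = n \<longrightarrow> f (x # xs) = poly (q xs) x"
    "\<forall>l. polyfun L n (\<lambda>xs. coeff (r xs) l)"
    "\<forall>x xs. length xs = n \<longrightarrow> g (x # xs) = poly (r xs) x" by blast
  then show ?case by (intro exI[of _ "\<lambda>xs. q xs + r xs"]) (auto intro: polyfun.intros)
next
  case (mult f g)
  then obtain q r where "\<forall>l. polyfun L n (\<lambda>xs. coeff (q xs) l)"
    "\<forall>x xs. length xs = n \<longrightarrow> f (x # xs) = poly (q xs) x"
    "\<forall>l. polyfun L n (\<lambda>xs. coeff (r xs) l)"
    "\<forall>x xs. length xs = n \<longrightarrow> g (x # xs) = poly (r xs) x" by blast
  then show ?case
    by (intro exI[of _ "\<lambda>xs. q xs * r xs"])
       (auto simp: coeff_mult intro!: polyfun_sum intro: polyfun.intros)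
next
  case (cong f g)
  then show ?case by (metis length_Cons)
qed

fun ring_tm :: "'f tm \<Rightarrow> bool" where
  "ring_tm (Neg t) \<longleftrightarrow> ring_tm t"
| "ring_tm (Add s t) \<longleftrightarrow> ring_tm s \<and> ring_tm t"
| "ring_tm (Mul s t) \<longleftrightarrow> ring_tm s \<and> ring_tm t"
| "ring_tm (Fn f ts) \<longleftrightarrow> False"
| "ring_tm _ \<longleftrightarrow> True"

lemma polyfun_eval_tm:
  assumes "ring_tm t" "is_tm (n + length bs) t"
  shows "polyfun (set bs) n (\<lambda>xs. eval_tm A t (xs @ bs))"
  using assms
proof (induction t)
  case (Var i)
  show ?case
  proof (cases "i < n")
    case True
    show ?thesis by (rule polyfun.cong[OF polyfun.coord[OF True]]) (simp add: nth_append True)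
  next
    case False
    then have "bs ! (i - n) \<in> set bs" using Var by simp
    from polyfun.const[OF this] show ?thesis
      by (rule polyfun.cong) (use False in \<open>simp add: nth_append\<close>)
  qed
qed (auto intro: polyfun.intros)

text \<open>
  Finitely many polynomial functions use finitely many coefficients.  With one common list of them
  fixed beforehand, terms are built without renaming the parameters.
\<close>

lemma polyfun_finite_params:
  assumes "polyfun L n f"
  shows "\<exists>bs. set bs \<subseteq> L \<and> polyfun (set bs) n f"
  using assms
proof (induction rule: polyfun.induct)
  case (const c)
  then show ?case by (intro exI[of _ "[c]"]) (auto intro: polyfun.intros)
next
  case (add f g)
  then obtain bs cs where "set bs \<subseteq> L" "polyfun (set bs) n f" "set cs \<subseteq> L" "polyfun (set cs) n g"
    by blast
  then show ?case
    by (intro exI[of _ "bs @ cs"]) (auto intro!: polyfun.add intro: polyfun_mono)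
next
  case (mult f g)
  then obtain bs cs where "set bs \<subseteq> L" "polyfun (set bs) n f" "set cs \<subseteq> L" "polyfun (set cs) n g"
    by blast
  then show ?case
    by (intro exI[of _ "bs @ cs"]) (auto intro!: polyfun.mult intro: polyfun_mono)
next
  case (uminus f)
  then show ?case by (blast intro: polyfun.uminus)
next
  case (cong f g)
  then show ?case by (blast intro: polyfun.cong)
qed (auto intro!: exI[of _ "[]"] polyfun.intros)

lemma polyfuns_finite_params:
  assumes "finite P" "\<And>f. f \<in> P \<Longrightarrow> polyfun L n f"
  shows "\<exists>bs. set bs \<subseteq> L \<and> (\<forall>f\<in>P. polyfun (set bs) n f)"
  using assms
proof (induction P rule: finite_induct)
  case empty
  show ?case by (intro exI[of _ "[]"]) simp
next
  case (insert f P)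
  then obtain bs where bs: "set bs \<subseteq> L" "\<forall>f\<in>P. polyfun (set bs) n f" by auto
  obtain cs where cs: "set cs \<subseteq> L" "polyfun (set cs) n f"
    using insert.prems[of f] polyfun_finite_params by blast
  show ?case
    by (intro exI[of _ "bs @ cs"]) (use bs cs in \<open>auto intro: polyfun_mono\<close>)
qed

lemma polyfun_tm:
  fixes A :: "('f::arity, 'r, 'a::field) struc"
  assumes "polyfun (set bs) n f"
  shows "\<exists>t. ring_tm t \<and> is_tm (n + length bs) t \<and>
             (\<forall>xs. length xs = n \<longrightarrow> eval_tm A t (xs @ bs) = f xs)"
  using assms
proof (induction rule: polyfun.induct)
  case (const c)
  then obtain i where "i < length bs" "bs ! i = c" by (auto simp: in_set_conv_nth)
  then show ?case by (intro exI[of _ "Var (n + i)"]) (auto simp: nth_append)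
next
  case zero
  show ?case by (intro exI[of _ Zero]) simp
next
  case one
  show ?case by (intro exI[of _ One]) simp
next
  case (coord i)
  then show ?case by (intro exI[of _ "Var i"]) (auto simp: nth_append)
next
  case (uminus f)
  then obtain t where "ring_tm t" "is_tm (n + length bs) t"
    "\<forall>xs. length xs = n \<longrightarrow> eval_tm A t (xs @ bs) = f xs" by blast
  then show ?case by (intro exI[of _ "Neg t"]) simp
next
  case (add f g)
  then obtain s t where "ring_tm s" "is_tm (n + length bs) s"
    "\<forall>xs. length xs = n \<longrightarrow> eval_tm A s (xs @ bs) = f xs" "ring_tm t" "is_tm (n + length bs) t"
    "\<forall>xs. length xs = n \<longrightarrow> eval_tm A t (xs @ bs) = g xs" by blast
  then show ?case by (intro exI[of _ "Add s t"]) simp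
next
  case (mult f g)
  then obtain s t where "ring_tm s" "is_tm (n + length bs) s"
    "\<forall>xs. length xs = n \<longrightarrow> eval_tm A s (xs @ bs) = f xs" "ring_tm t" "is_tm (n + length bs) t"
    "\<forall>xs. length xs = n \<longrightarrow> eval_tm A t (xs @ bs) = g xs" by blast
  then show ?case by (intro exI[of _ "Mul s t"]) simp
next
  case (cong f g)
  then show ?case by metis
qed

lemma mpol_eval_sum:
  assumes "finite S" "Poly_Mapping.keys p \<subseteq> S"
  shows "mpol_eval p xs = (\<Sum>m\<in>S. Poly_Mapping.lookup p m *
           (\<Prod>i\<in>Poly_Mapping.keys m. xs ! i ^ Poly_Mapping.lookup m i))"
  unfolding mpol_eval_def mpol_subst_def
  by (rule sum.mono_neutral_left) (use assms in \<open>auto simp: in_keys_iff\<close>)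

lemma polyfun_mpol_eval:
  assumes "p \<in> mpol_vars_below n"
  shows "polyfun UNIV n (mpol_eval p)"
  unfolding mpol_eval_def mpol_subst_def
  by (intro polyfun_sum polyfun.mult polyfun_prod polyfun_power polyfun.const polyfun.coord)
     (use assms in \<open>auto simp: mpol_vars_below_def\<close>)

lemma poly_mpol_fibre:
  assumes "p \<in> mpol_vars_below (Suc (length as))"
  shows "poly (mpol_fibre p as) y = mpol_eval p (as @ [y])"
proof -
  have "poly (if i < length as then [:as ! i:] else [:0, 1:]) y = (as @ [y]) ! i"
    if "m \<in> Poly_Mapping.keys p" "i \<in> Poly_Mapping.keys m" for m i
  proof -
    have "i < Suc (length as)" using that assms by (auto simp: mpol_vars_below_def)
    then show ?thesis by (auto simp: nth_append less_Suc_eq)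
  qed
  then show ?thesis
    unfolding mpol_fibre_def mpol_eval_def mpol_subst_def
    by (simp add: poly_sum poly_prod)
qed

section \<open>Algebraic boundedness in elementarily equivalent structures\<close>

text \<open>
  The conclusion of algebraic boundedness at one tuple.  As the field is infinite, a polynomial
  is nonzero iff it has a nonzero value, so its coefficients need not be written out.
\<close>

definition covered :: "nat \<Rightarrow> nat \<Rightarrow> ('f, 'r) fm \<Rightarrow> 'f tm list \<Rightarrow> ('f, 'r) fm" where
  "covered N n \<phi> ts = Imp (at_most N n \<phi>)
     (DisjL (map (\<lambda>t. And (Ex (Not (Eq t Zero))) (Forall (Imp \<phi> (Eq t Zero)))) ts))"

lemma is_fm_covered:
  assumes "is_fm (Suc n) \<phi>" "\<And>t. t \<in> set ts \<Longrightarrow> is_tm (Suc (n + k)) t"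
  shows "is_fm (n + k) (covered N n \<phi> ts)"
  using assms by (auto simp: covered_def intro: is_fm_mono is_fm_at_most)

lemma sat_covered:
  assumes "is_fm (Suc (length as)) \<phi>"
  shows "sat A (covered N (length as) \<phi> ts) (as @ cs) \<longleftrightarrow>
    (finite {y. sat A \<phi> (y # as)} \<and> card {y. sat A \<phi> (y # as)} \<le> N \<longrightarrow>
     (\<exists>t\<in>set ts. (\<exists>y. eval_tm A t (y # as @ cs) \<noteq> 0) \<and>
                  (\<forall>y. sat A \<phi> (y # as) \<longrightarrow> eval_tm A t (y # as @ cs) = 0)))"
proof -
  have "sat A \<phi> (y # as @ cs) \<longleftrightarrow> sat A \<phi> (y # as)" for y
    using sat_append[of "y # as" \<phi> A cs] assms by simp
  then show ?thesis
    using assms sat_append[OF is_fm_at_most[OF assms], of A N cs]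
    by (simp add: covered_def sat_at_most)
qed

text \<open>
  The coefficients of the polynomials become parameters \<open>cs\<close> of the terms, so that they can be
  quantified.
\<close>

lemma alg_bounded_covered:
  fixes K :: "('f::arity, 'r::arity, 'k::field_char_0) struc"
  assumes "alg_bounded K F" and \<phi>: "is_fm (Suc n) \<phi>"
  shows "\<exists>cs ts. (\<forall>t\<in>set ts. ring_tm t \<and> is_tm (Suc (n + length cs)) t) \<and>
           sat K (AllN n (covered N n \<phi> ts)) cs"
proof -
  \<comment> \<open>The distinguished variable is the last one for \<^const>\<open>alg_bounded\<close>, but the first one for \<^const>\<open>acl\<close>.\<close>
  define \<phi>' where "\<phi>' = reindex (n # [0..<n]) \<phi>"
  have "is_fm (Suc n) \<phi>'"
    unfolding \<phi>'_def using \<phi> by (intro is_fm_reindex) auto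
  moreover have \<phi>': "sat K \<phi>' (as @ [y]) \<longleftrightarrow> sat K \<phi> (y # as)" if "length as = n" for as y
    using \<phi> that map_nth_take[of n "as @ [y]"] by (simp add: \<phi>'_def sat_reindex nth_append)
  ultimately obtain P where P: "finite P" "P \<subseteq> mpol_vars_below (Suc n)"
    "\<And>as. length as = n \<Longrightarrow> finite {y. sat K \<phi> (y # as)} \<Longrightarrow>
       \<exists>p\<in>P. mpol_fibre p as \<noteq> 0 \<and> {y. sat K \<phi> (y # as)} \<subseteq> {y. poly (mpol_fibre p as) y = 0}"
    using assms(1)[unfolded alg_bounded_def, rule_format, of n \<phi>'] by fastforce
  define f where "f p xs = mpol_eval p (tl xs @ [hd xs])" for p and xs :: "'k list"
  have poly: "polyfun UNIV (Suc n) (f p)" if "p \<in> P" for p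
  proof -
    have "polyfun UNIV (Suc n)
        (\<lambda>xs. mpol_eval p (map (\<lambda>c. c xs) (map (\<lambda>i xs. xs ! i) ([1..<Suc n] @ [0]))))"
      using P that by (intro polyfun_comp[OF polyfun_mpol_eval])
         (auto intro: polyfun.coord simp del: upt_Suc)
    then show ?thesis
      unfolding f_def
    proof (rule polyfun.cong)
      fix xs :: "'k list" assume "length xs = Suc n"
      then obtain y as where "xs = y # as" "length as = n" by (auto simp: length_Suc_conv)
      then show "mpol_eval p (map (\<lambda>c. c xs) (map (\<lambda>i xs. xs ! i) ([1..<Suc n] @ [0]))) =
          mpol_eval p (tl xs @ [hd xs])"
        using map_nth_shift[of "[y]" as] by (simp add: comp_def del: upt_Suc)
    qed
  qed
  obtain cs where cs: "\<And>p. p \<in> P \<Longrightarrow> polyfun (set cs) (Suc n) (f p)"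
    using polyfuns_finite_params[of "f ` P" UNIV "Suc n"] P(1) poly by auto
  then have "\<exists>t. ring_tm t \<and> is_tm (Suc (n + length cs)) t \<and>
      (\<forall>xs. length xs = Suc n \<longrightarrow> eval_tm K t (xs @ cs) = f p xs)" if "p \<in> P" for p
    using polyfun_tm[OF cs[OF that], of K] by simp
  then obtain t where t: "\<And>p. p \<in> P \<Longrightarrow> ring_tm (t p) \<and> is_tm (Suc (n + length cs)) (t p) \<and>
      (\<forall>xs. length xs = Suc n \<longrightarrow> eval_tm K (t p) (xs @ cs) = f p xs)" by metis
  obtain ps where ps: "set ps = P" using P(1) finite_list by blast
  show ?thesis
  proof (intro exI conjI)
    show "\<forall>t\<in>set (map t ps). ring_tm t \<and> is_tm (Suc (n + length cs)) t"
      using t ps by auto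
    have "sat K (covered N n \<phi> (map t ps)) (as @ cs)" if as: "length as = n" for as
    proof -
      have "\<exists>p\<in>P. (\<exists>y. eval_tm K (t p) (y # as @ cs) \<noteq> 0) \<and>
                  (\<forall>y. sat K \<phi> (y # as) \<longrightarrow> eval_tm K (t p) (y # as @ cs) = 0)"
        if fin: "finite {y. sat K \<phi> (y # as)}"
      proof -
        obtain p where p: "p \<in> P" "mpol_fibre p as \<noteq> 0"
          "{y. sat K \<phi> (y # as)} \<subseteq> {y. poly (mpol_fibre p as) y = 0}"
          using P(3)[OF as fin] by blast
        have "eval_tm K (t p) (y # as @ cs) = poly (mpol_fibre p as) y" for y
          using t[OF p(1)] P(2) p(1) as poly_mpol_fibre[of p as y]
          by (auto simp: f_def dest!: spec[of _ "y # as"])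
        then show ?thesis using p poly_all_0_iff_0[of "mpol_fibre p as"] by fastforce
      qed
      then show ?thesis using \<phi> as ps sat_covered[of as \<phi> K N] by auto
    qed
    then show "sat K (AllN n (covered N n \<phi> (map t ps))) cs" by simp
  qed
qed

text \<open>
  For fixed \<open>N\<close>, algebraic boundedness for the sets with at most \<open>N\<close> points is implied by one
  sentence, which quantifies the coefficients existentially.  The sentence passes from \<open>K\<close> to \<open>M\<close>,
  and witnesses in \<open>M\<close> also work in \<open>U\<close>.  Hence the coefficients, which may depend on \<open>N\<close>, are in
  the image of \<open>M\<close>.
\<close>

lemma alg_bounded_transfer:
  fixes K :: "('f::arity, 'r::arity, 'k::field_char_0) struc"
    and M :: "('f, 'r, 'm::field_char_0) struc"
    and U :: "('f, 'r, 'u::field_char_0) struc"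
  assumes "alg_bounded K F" "models M (Th K)" "elementary_embedding j M U"
    and \<phi>: "is_fm (Suc (length as)) \<phi>" "finite {y. sat U \<phi> (y # as)}"
  obtains f where "polyfun (range j) (Suc (length as)) f" "\<exists>y. f (y # as) \<noteq> 0"
    "\<And>y. sat U \<phi> (y # as) \<Longrightarrow> f (y # as) = 0"
proof -
  define n where "n = length as"
  define N where "N = card {y. sat U \<phi> (y # as)}"
  obtain cs :: "'k list" and ts where
    ts: "\<And>t. t \<in> set ts \<Longrightarrow> ring_tm t \<and> is_tm (Suc (n + length cs)) t"
    and K: "sat K (AllN n (covered N n \<phi> ts)) cs"
    using alg_bounded_covered[OF assms(1), of n \<phi> N] \<phi> n_def by blast
  define l where "l = length cs"
  have fm: "is_fm l (AllN n (covered N n \<phi> ts))"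
    using ts \<phi> is_fm_covered[of n \<phi> ts l N] by (simp add: l_def n_def)
  have "sat K (ExN l (AllN n (covered N n \<phi> ts))) []"
    using K by (auto simp: l_def simp del: sat_AllN)
  then have "ExN l (AllN n (covered N n \<phi> ts)) \<in> Th K"
    using fm by (simp add: Th_def)
  then have "sat M (ExN l (AllN n (covered N n \<phi> ts))) []"
    using assms(2) by (auto simp only: models_def)
  then obtain ds where ds: "length ds = l" "sat M (AllN n (covered N n \<phi> ts)) ds"
    by (auto simp del: sat_AllN)
  then have "sat U (AllN n (covered N n \<phi> ts)) (map j ds)"
    using assms(3) fm by (auto simp only: elementary_embedding_def)
  then have "sat U (covered N n \<phi> ts) (as @ map j ds)"
    by (simp add: n_def)
  then obtain t where t: "t \<in> set ts" "\<exists>y. eval_tm U t (y # as @ map j ds) \<noteq> 0"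
    "\<forall>y. sat U \<phi> (y # as) \<longrightarrow> eval_tm U t (y # as @ map j ds) = 0"
    using sat_covered[OF \<phi>(1), of U N ts "map j ds"] \<phi>(2) by (auto simp: n_def N_def)
  show thesis
  proof (rule that)
    have "polyfun (set (map j ds)) (Suc (length as)) (\<lambda>xs. eval_tm U t (xs @ map j ds))"
      using ts[OF t(1)] ds by (intro polyfun_eval_tm) (auto simp: n_def l_def)
    then show "polyfun (range j) (Suc (length as)) (\<lambda>xs. eval_tm U t (xs @ map j ds))"
      by (rule polyfun_mono) auto
  qed (use t in auto)
qed


section \<open>Independent tuples in the monster model\<close>

lemma acl_mono: "A \<subseteq> B \<Longrightarrow> acl M A \<subseteq> acl M B"
  unfolding acl_def by blast

lemma acl_indep_mono:
  assumes "acl_indep M B A" "B' \<subseteq> B" "A' \<subseteq> A"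
  shows "acl_indep M B' A'"
proof -
  have "acl M (B' \<union> (A' - {a})) \<subseteq> acl M (B \<union> (A - {a}))" for a
    using assms(2,3) by (intro acl_mono) auto
  then show ?thesis using assms(1,3) unfolding acl_indep_def by blast
qed

text \<open>
  The negations of the formulas over \<open>A\<close> with finitely many solutions can be added to a type
  all of whose finite parts have infinitely many realisations.
\<close>

lemma monster_realise_nonalgebraic:
  fixes M :: "('f::arity, 'r::arity, 'm::field_char_0) struc"
    and U :: "('f, 'r, 'u::field_char_0) struc"
  assumes "monster j M U" "A \<lesssim> (UNIV :: 'm set)"
    and fm: "\<And>\<phi> bs. (\<phi>, bs) \<in> \<Gamma> \<Longrightarrow> set bs \<subseteq> A \<and> is_fm (Suc (length bs)) \<phi>"
    and inf: "\<And>\<Gamma>0. finite \<Gamma>0 \<Longrightarrow> \<Gamma>0 \<subseteq> \<Gamma> \<Longrightarrow> infinite {x. \<forall>(\<phi>, bs)\<in>\<Gamma>0. sat U \<phi> (x # bs)}"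
  obtains x where "\<And>\<phi> bs. (\<phi>, bs) \<in> \<Gamma> \<Longrightarrow> sat U \<phi> (x # bs)" "x \<notin> acl U A"
proof -
  define \<Delta> where "\<Delta> = {(Not \<phi>, bs) | \<phi> bs. set bs \<subseteq> A \<and> is_fm (Suc (length bs)) \<phi> \<and>
                                            finite {x. sat U \<phi> (x # bs)}}"
  have "\<exists>x. \<forall>(\<phi>, bs)\<in>\<Gamma>0. sat U \<phi> (x # bs)" if \<Gamma>0: "finite \<Gamma>0" "\<Gamma>0 \<subseteq> \<Gamma> \<union> \<Delta>" for \<Gamma>0
  proof -
    have "finite (\<Union>(\<psi>, bs)\<in>\<Gamma>0 \<inter> \<Delta>. {x. \<not> sat U \<psi> (x # bs)})"
      using \<Gamma>0(1) by (auto simp: \<Delta>_def)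
    moreover have "infinite {x. \<forall>(\<phi>, bs)\<in>\<Gamma>0 \<inter> \<Gamma>. sat U \<phi> (x # bs)}"
      using \<Gamma>0(1) by (intro inf) auto
    ultimately have "infinite ({x. \<forall>(\<phi>, bs)\<in>\<Gamma>0 \<inter> \<Gamma>. sat U \<phi> (x # bs)} -
        (\<Union>(\<psi>, bs)\<in>\<Gamma>0 \<inter> \<Delta>. {x. \<not> sat U \<psi> (x # bs)}))"
      by (rule Diff_infinite_finite)
    then obtain x where x: "x \<in> {x. \<forall>(\<phi>, bs)\<in>\<Gamma>0 \<inter> \<Gamma>. sat U \<phi> (x # bs)} -
        (\<Union>(\<psi>, bs)\<in>\<Gamma>0 \<inter> \<Delta>. {x. \<not> sat U \<psi> (x # bs)})"
      using infinite_imp_nonempty by blast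
    have "sat U \<phi> (x # bs)" if "(\<phi>, bs) \<in> \<Gamma>0" for \<phi> bs
    proof (cases "(\<phi>, bs) \<in> \<Gamma>")
      case True
      then show ?thesis using x that by auto
    next
      case False
      then have "(\<phi>, bs) \<in> \<Gamma>0 \<inter> \<Delta>" using \<Gamma>0(2) that by auto
      then show ?thesis using x by auto
    qed
    then show ?thesis by auto
  qed
  moreover have "\<forall>(\<phi>, bs)\<in>\<Gamma> \<union> \<Delta>. set bs \<subseteq> A \<and> is_fm (Suc (length bs)) \<phi>"
    using fm by (auto simp: \<Delta>_def)
  ultimately have "\<exists>x. \<forall>(\<phi>, bs)\<in>\<Gamma> \<union> \<Delta>. sat U \<phi> (x # bs)"
    using assms(1)[unfolded monster_def, THEN conjunct2, THEN spec[where x = A],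
        THEN spec[where x = "\<Gamma> \<union> \<Delta>"]] assms(2) by simp
  then obtain x where x: "\<forall>(\<phi>, bs)\<in>\<Gamma> \<union> \<Delta>. sat U \<phi> (x # bs)" ..
  have "x \<notin> acl U A"
  proof
    assume "x \<in> acl U A"
    then obtain \<phi> bs where "set bs \<subseteq> A" "is_fm (Suc (length bs)) \<phi>"
      "finite {x. sat U \<phi> (x # bs)}" "sat U \<phi> (x # bs)"
      unfolding acl_def by blast
    then show False using x by (force simp: \<Delta>_def)
  qed
  then show thesis using that x by blast
qed

text \<open>
  Independence built up one element at a time, the last one being at the head of the list.  Types
  can be extended in this form, and it agrees with independence once exchange is known.
\<close>

fun seq_indep :: "('f::arity, 'r::arity, 'a::field) struc \<Rightarrow> 'a set \<Rightarrow> 'a list \<Rightarrow> bool" where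
  "seq_indep M B [] \<longleftrightarrow> True"
| "seq_indep M B (u # us) \<longleftrightarrow> u \<notin> acl M (B \<union> set us) \<and> seq_indep M B us"

lemma acl_indep_imp_seq_indep:
  "distinct us \<Longrightarrow> acl_indep M B (set us) \<Longrightarrow> seq_indep M B us"
proof (induction us)
  case (Cons u us)
  have "acl_indep M B (set us)"
    by (rule acl_indep_mono[OF Cons.prems(2)]) auto
  moreover have "set (u # us) - {u} = set us" using Cons.prems(1) by auto
  ultimately show ?case using Cons by (simp add: acl_indep_def)
qed simp

lemma range_Un_finite_lepoll:
  fixes j :: "'m::field_char_0 \<Rightarrow> 'u"
  assumes "finite S"
  shows "range j \<union> S \<lesssim> (UNIV :: 'm set)"
  using assms
proof (induction S rule: finite_induct)
  case (insert s S)
  have "infinite (UNIV :: 'm set)" by (rule infinite_UNIV_char_0)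
  show ?case
  proof (cases "finite (range j \<union> S)")
    case True
    then show ?thesis
      using \<open>infinite UNIV\<close> by (intro finite_lepoll_infinite) auto
  next
    case False
    then have "insert s (range j \<union> S) \<lesssim> range j \<union> S" by (rule infinite_insert_lepoll)
    then show ?thesis using insert.IH lepoll_trans by auto
  qed
qed (simp add: image_lepoll)

text \<open>
  An independent tuple over a small set of parameters has a copy, of the same type over these
  parameters, which is independent over the whole small model.  So the dimension of a definable
  set does not depend on the parameters used to define it.
\<close>

lemma seq_indep_same_type:
  fixes M :: "('f::arity, 'r::arity, 'm::field_char_0) struc"
    and U :: "('f, 'r, 'u::field_char_0) struc"
  assumes "monster j M U" "set bs \<subseteq> range j" "seq_indep U (set bs) us"
  shows "\<exists>vs. length vs = length us \<and> seq_indep U (range j) vs \<and>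
           (\<forall>\<phi>. is_fm (length us + length bs) \<phi> \<longrightarrow> sat U \<phi> (us @ bs) \<longleftrightarrow> sat U \<phi> (vs @ bs))"
  using assms(3)
proof (induction us)
  case (Cons u us)
  then have "seq_indep U (set bs) us" by simp
  from Cons.IH[OF this] obtain vs where "length vs = length us \<and> seq_indep U (range j) vs \<and>
      (\<forall>\<phi>. is_fm (length us + length bs) \<phi> \<longrightarrow> sat U \<phi> (us @ bs) \<longleftrightarrow> sat U \<phi> (vs @ bs))" ..
  then have vs: "length vs = length us" "seq_indep U (range j) vs"
    "\<And>\<phi>. is_fm (length us + length bs) \<phi> \<Longrightarrow> sat U \<phi> (us @ bs) \<longleftrightarrow> sat U \<phi> (vs @ bs)"
    by simp_all
  let ?k = "length us + length bs"
  define \<Gamma> where "\<Gamma> = {(\<phi>, vs @ bs) | \<phi>. is_fm (Suc ?k) \<phi> \<and> sat U \<phi> (u # us @ bs)}"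
  have inf: "infinite {x. \<forall>(\<phi>, cs)\<in>\<Gamma>0. sat U \<phi> (x # cs)}" if \<Gamma>0: "finite \<Gamma>0" "\<Gamma>0 \<subseteq> \<Gamma>" for \<Gamma>0
  proof
    assume fin: "finite {x. \<forall>(\<phi>, cs)\<in>\<Gamma>0. sat U \<phi> (x # cs)}"
    obtain \<phi>s where \<phi>s: "set \<phi>s = fst ` \<Gamma>0"
      using finite_list[OF finite_imageI[OF \<Gamma>0(1), of fst]] by auto
    define \<psi> where "\<psi> = ConjL \<phi>s"
    have \<Gamma>0D: "cs = vs @ bs" "is_fm (Suc ?k) \<phi>" "sat U \<phi> (u # us @ bs)" if "(\<phi>, cs) \<in> \<Gamma>0" for \<phi> cs
      using \<Gamma>0(2) that unfolding \<Gamma>_def by blast+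
    have mem: "\<phi> \<in> set \<phi>s \<longleftrightarrow> (\<exists>cs. (\<phi>, cs) \<in> \<Gamma>0)" for \<phi>
      unfolding \<phi>s by force
    have \<psi>: "is_fm (Suc ?k) \<psi>" "sat U \<psi> (u # us @ bs)"
      unfolding \<psi>_def using mem \<Gamma>0D(2,3) by auto
    have "{x. sat U \<psi> (x # vs @ bs)} \<subseteq> {x. \<forall>(\<phi>, cs)\<in>\<Gamma>0. sat U \<phi> (x # cs)}"
    proof (intro subsetI CollectI ballI, clarify)
      fix x \<phi> cs assume "sat U \<psi> (x # vs @ bs)" "(\<phi>, cs) \<in> \<Gamma>0"
      then show "sat U \<phi> (x # cs)"
        using mem[of \<phi>] \<Gamma>0D(1) unfolding \<psi>_def sat_combinators by blast
    qed
    with fin have "finite {x. sat U \<psi> (x # vs @ bs)}" by (rule rev_finite_subset)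
    then obtain N where "sat U (at_most N ?k \<psi>) (vs @ bs)"
      using sat_at_most[OF \<psi>(1), of "vs @ bs" U] vs(1) by auto
    then have "sat U (at_most N ?k \<psi>) (us @ bs)"
      using vs(3) is_fm_at_most[OF \<psi>(1)] by blast
    then have "finite {x. sat U \<psi> (x # us @ bs)}"
      using sat_at_most[OF \<psi>(1), of "us @ bs" U] by simp
    then have "u \<in> acl U (set bs \<union> set us)"
      unfolding acl_def using \<psi> by (intro CollectI exI[of _ \<psi>] exI[of _ "us @ bs"]) auto
    then show False using Cons.prems by simp
  qed
  have fm: "set cs \<subseteq> range j \<union> set vs \<and> is_fm (Suc (length cs)) \<phi>" if "(\<phi>, cs) \<in> \<Gamma>" for \<phi> cs
    using that assms(2) vs(1) by (auto simp: \<Gamma>_def)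
  obtain v where v: "\<And>\<phi> cs. (\<phi>, cs) \<in> \<Gamma> \<Longrightarrow> sat U \<phi> (v # cs)"
    "v \<notin> acl U (range j \<union> set vs)"
    by (rule monster_realise_nonalgebraic[OF assms(1) range_Un_finite_lepoll[OF List.finite_set],
          of \<Gamma>, OF fm inf]) (assumption | rule that)+
  have imp: "sat U \<phi> (v # vs @ bs)" if "is_fm (Suc ?k) \<phi>" "sat U \<phi> (u # us @ bs)" for \<phi>
    using that v(1) by (auto simp: \<Gamma>_def)
  have "sat U \<phi> (u # us @ bs) \<longleftrightarrow> sat U \<phi> (v # vs @ bs)" if "is_fm (Suc ?k) \<phi>" for \<phi>
    using imp[of \<phi>] imp[of "Not \<phi>"] that by auto
  then show ?case
    using vs v(2) by (intro exI[of _ "v # vs"]) simp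
qed simp

lemma seq_indep_exists:
  fixes M :: "('f::arity, 'r::arity, 'm::field_char_0) struc"
    and U :: "('f, 'r, 'u::field_char_0) struc"
  assumes "monster j M U"
  shows "\<exists>us. length us = k \<and> seq_indep U (range j) us"
proof (induction k)
  case (Suc k)
  then obtain us where us: "length us = k" "seq_indep U (range j) us" by blast
  have "infinite (UNIV :: 'u set)" by (rule infinite_UNIV_char_0)
  then obtain u where "u \<notin> acl U (range j \<union> set us)"
    using monster_realise_nonalgebraic[OF assms range_Un_finite_lepoll, of "set us" "{}"] by auto
  then show ?case using us by (intro exI[of _ "u # us"]) simp
qed simp

lemma polyfun_root_in_acl:
  fixes U :: "('f::arity, 'r::arity, 'u::field) struc"
  assumes "polyfun L (Suc (length us)) f" "finite {x. f (x # us) = 0}" "f (u # us) = 0"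
  shows "u \<in> acl U (L \<union> set us)"
proof -
  obtain bs where bs: "set bs \<subseteq> L" "polyfun (set bs) (Suc (length us)) f"
    using polyfun_finite_params[OF assms(1)] by blast
  obtain t where t: "is_tm (Suc (length us) + length bs) t"
    "\<And>xs. length xs = Suc (length us) \<Longrightarrow> eval_tm U t (xs @ bs) = f xs"
    using polyfun_tm[OF bs(2), of U] by blast
  have "eval_tm U t (x # us @ bs) = f (x # us)" for x
    using t(2)[of "x # us"] by simp
  then show ?thesis
    unfolding acl_def using assms bs(1) t(1)
    by (intro CollectI exI[of _ "Eq t Zero"] exI[of _ "us @ bs"]) auto
qed

text \<open>
  A sequentially independent tuple is a generic point: by induction, the coefficients of a
  polynomial in the last element vanish since it would be algebraic otherwise.
\<close>

lemma seq_indep_polyfun_zero: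
  fixes U :: "('f::arity, 'r::arity, 'u::field) struc"
  assumes "seq_indep U L us" "polyfun L (length us) f" "f us = 0" "length xs = length us"
  shows "f xs = 0"
  using assms
proof (induction us arbitrary: f xs)
  case (Cons u us)
  then obtain q where q: "\<And>l. polyfun L (length us) (\<lambda>xs. coeff (q xs) l)"
    "\<And>x xs. length xs = length us \<Longrightarrow> f (x # xs) = poly (q xs) x"
    using polyfun_poly[of L "length us" f] by auto
  have "q us = 0"
  proof (rule ccontr)
    assume "q us \<noteq> 0"
    then have "finite {x. f (x # us) = 0}" using q(2) poly_roots_finite by simp
    then have "u \<in> acl U (L \<union> set us)"
      using Cons.prems(2,3) by (intro polyfun_root_in_acl[of _ _ f]) auto
    then show False using Cons.prems by simp
  qed
  then have "coeff (q ys) l = 0" if "length ys = length us" for ys l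
    using Cons.IH[OF _ q(1)[of l] _ that] Cons.prems(1) by simp
  then have "q ys = 0" if "length ys = length us" for ys
    using that by (intro poly_eqI) simp
  moreover obtain x ys where "xs = x # ys" "length ys = length us"
    using Cons.prems(4) by (auto simp: length_Suc_conv)
  ultimately show ?case using q(2) by simp
qed simp

locale alg_bounded_monster =
  fixes K :: "('f::arity, 'r::arity, 'k::field_char_0) struc"
    and F :: "'k set"
    and M :: "('f, 'r, 'm::field_char_0) struc"
    and U :: "('f, 'r, 'u::field_char_0) struc"
    and j :: "'m \<Rightarrow> 'u"
  assumes alg_bounded: "alg_bounded K F"
    and model: "models M (Th K)"
    and monster: "monster j M U"
begin

lemma elementary: "elementary_embedding j M U"
  using monster by (simp add: monster_def)

text \<open>
  This is where algebraic boundedness enters.  If an element \<open>us ! i\<close> were algebraic over the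
  others, it would be a zero of a nonzero polynomial over them; but a polynomial vanishing at the
  generic point \<open>us\<close> vanishes identically.
\<close>

lemma seq_indep_imp_acl_indep:
  assumes "seq_indep U (range j) us"
  shows "distinct us \<and> acl_indep U (range j) (set us)"
proof
  show "distinct us"
    using assms
  proof (induction us)
    case (Cons u us)
    have "u \<notin> set us"
    proof
      assume "u \<in> set us"
      have "u \<in> acl U (range j \<union> set us)"
        unfolding acl_def
        by (intro CollectI exI[of _ "Eq (Var 0) (Var 1)"] exI[of _ "[u]"])
           (use \<open>u \<in> set us\<close> in auto)
      then show False using Cons.prems by simp
    qed
    then show ?case using Cons by simp
  qed simp
  then have idx: "us ! i = us ! k \<longleftrightarrow> i = k" if "i < length us" "k < length us" for i k
    using that nth_eq_iff_index_eq by blast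
  show "acl_indep U (range j) (set us)"
    unfolding acl_indep_def
  proof (intro ballI notI)
    fix a assume "a \<in> set us" and a: "a \<in> acl U (range j \<union> (set us - {a}))"
    then obtain i where i: "i < length us" "us ! i = a" by (auto simp: in_set_conv_nth)
    obtain \<phi> ds where ds: "set ds \<subseteq> range j \<union> (set us - {a})" "is_fm (Suc (length ds)) \<phi>"
      "finite {x. sat U \<phi> (x # ds)}" "sat U \<phi> (a # ds)"
      using a unfolding acl_def by blast
    obtain f where f: "polyfun (range j) (Suc (length ds)) f" "\<exists>y. f (y # ds) \<noteq> 0"
      "\<And>y. sat U \<phi> (y # ds) \<Longrightarrow> f (y # ds) = 0"
      using alg_bounded_transfer[OF alg_bounded model elementary ds(2,3)] by blast
    \<comment> \<open>Replace the parameters that occur in \<open>us\<close> by variables; \<open>g us = f (a # ds)\<close>.\<close>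
    define pos where "pos d = (SOME k. k < length us \<and> us ! k = d)" for d
    have pos: "pos d < length us" "us ! pos d = d" if "d \<in> set us" for d
      using someI_ex[of "\<lambda>k. k < length us \<and> us ! k = d"] that
      by (auto simp: pos_def in_set_conv_nth)
    define h where "h d = (\<lambda>xs. if d \<in> set us - {a} then xs ! pos d else d)" for d
    define g where "g xs = f (map (\<lambda>c. c xs) ((\<lambda>xs. xs ! i) # map h ds))" for xs
    have "polyfun (range j) (length us) (h d)" if "d \<in> set ds" for d
    proof (cases "d \<in> set us - {a}")
      case True
      then show ?thesis using pos(1)[of d] by (simp add: h_def polyfun.coord)
    next
      case False
      then have "h d = (\<lambda>_. d)" "d \<in> range j" using ds(1) that by (auto simp: h_def)
      then show ?thesis by (simp add: polyfun.const)
    qed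
    then have "polyfun (range j) (length us) g"
      unfolding g_def using i by (intro polyfun_comp[OF f(1)]) (auto intro: polyfun.coord)
    moreover have "h d us = d" for d
      using pos by (auto simp: h_def)
    then have "g us = 0"
      using f(3)[OF ds(4)] i by (simp add: g_def comp_def)
    ultimately have zero: "g (us[i := y]) = 0" for y
      using seq_indep_polyfun_zero[OF assms] by simp
    \<comment> \<open>No parameter is read off at position \<open>i\<close>, so changing this entry only changes the first
      argument of \<open>f\<close>.\<close>
    have "h d (us[i := y]) = d" for d y
      using pos[of d] i by (auto simp: h_def nth_list_update)
    then have "g (us[i := y]) = f (y # ds)" for y
      using i by (simp add: g_def comp_def)
    then show False using zero f(2) by simp
  qed
qed

end

section \<open>Dimension\<close>

lemma rk_le_length: "rk U as bs \<le> length as"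
proof -
  have "finite {card A | A. A \<subseteq> set as \<and> acl_indep U (set bs) A}" by simp
  moreover have "card {} \<in> {card A | A. A \<subseteq> set as \<and> acl_indep U (set bs) A}"
    by (auto simp: acl_indep_def intro!: exI[of _ "{}"])
  moreover have "card A \<le> length as" if "A \<subseteq> set as" for A
    using that by (meson List.finite_set card_length card_mono le_trans)
  ultimately show ?thesis
    unfolding rk_def by (subst Max_le_iff) blast+
qed

lemma rk_ge: "A \<subseteq> set as \<Longrightarrow> acl_indep U (set bs) A \<Longrightarrow> card A \<le> rk U as bs"
  unfolding rk_def by (rule Max_ge) auto

lemma rk_attained: "\<exists>A. A \<subseteq> set as \<and> acl_indep U (set bs) A \<and> card A = rk U as bs"
proof -
  have "Max {card A | A. A \<subseteq> set as \<and> acl_indep U (set bs) A}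
      \<in> {card A | A. A \<subseteq> set as \<and> acl_indep U (set bs) A}"
    by (rule Max_in) (auto simp: acl_indep_def intro!: exI[of _ "{}"])
  then show ?thesis unfolding rk_def by auto
qed

definition coords :: "nat list \<Rightarrow> 'a list \<Rightarrow> 'a list" where
  "coords is xs = map ((!) xs) is"

text \<open>The formula defining the image of a definable subset of \<open>M\<^sup>n\<close> under \<^const>\<open>coords\<close>.\<close>

definition proj_fm :: "nat \<Rightarrow> nat list \<Rightarrow> nat \<Rightarrow> ('f, 'r) fm \<Rightarrow> ('f, 'r) fm" where
  "proj_fm n is l \<phi> = ExN n (And (reindex ([0..<n] @ [n + length is..<n + length is + l]) \<phi>)
                                 (eqs is [n..<n + length is]))"

lemma is_fm_proj_fm:
  "is_fm (n + l) \<phi> \<Longrightarrow> set is \<subseteq> {..<n} \<Longrightarrow> is_fm (length is + l) (proj_fm n is l \<phi>)"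
  unfolding proj_fm_def by (auto intro!: is_fm_reindex is_fm_eqs)

lemma def_set_proj_fm:
  assumes "is_fm (n + length bs) \<phi>" "set is \<subseteq> {..<n}"
  shows "def_set A (length is) (proj_fm n is (length bs) \<phi>) bs = coords is ` def_set A n \<phi> bs"
proof -
  have "sat A (proj_fm n is (length bs) \<phi>) (us @ bs) \<longleftrightarrow>
      (\<exists>ys. length ys = n \<and> sat A \<phi> (ys @ bs) \<and> coords is ys = us)"
    if us: "length us = length is" for us
  proof -
    have "sat A (reindex ([0..<n] @ [n + length is..<n + length is + length bs]) \<phi>) (ys @ us @ bs)
        \<longleftrightarrow> sat A \<phi> (ys @ bs)" if "length ys = n" for ys
      using that us assms(1) map_nth_take[of n "ys @ us @ bs"] map_nth_shift[of "ys @ us" bs]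
      by (simp add: sat_reindex)
    moreover have "map ((!) (ys @ us @ bs)) [n..<n + length is] = us" if "length ys = n" for ys
      using that us by (intro nth_equalityI) (auto simp: nth_append)
    moreover have "map ((!) (ys @ us @ bs)) is = coords is ys" if "length ys = n" for ys
      using that assms(2) by (auto simp: coords_def nth_append subset_iff)
    ultimately show ?thesis by (auto simp: proj_fm_def)
  qed
  then show ?thesis by (auto simp: def_set_def coords_def)
qed

text \<open>
  Inclusion between two definable sets; the environment consists of the parameters of the smaller
  set followed by those of the bigger one.
\<close>

definition incl_fm :: "nat \<Rightarrow> nat \<Rightarrow> nat \<Rightarrow> ('f, 'r) fm \<Rightarrow> ('f, 'r) fm \<Rightarrow> ('f, 'r) fm" where
  "incl_fm k l m \<phi> \<psi> = AllN k (Imp \<phi> (reindex ([0..<k] @ [k + l..<k + l + m]) \<psi>))"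

lemma is_fm_incl_fm:
  "is_fm (k + l) \<phi> \<Longrightarrow> is_fm (k + m) \<psi> \<Longrightarrow> is_fm (l + m) (incl_fm k l m \<phi> \<psi>)"
  unfolding incl_fm_def by (auto intro!: is_fm_reindex intro: is_fm_mono)

lemma sat_incl_fm:
  assumes "is_fm (k + length bs) \<phi>" "is_fm (k + length cs) \<psi>"
  shows "sat A (incl_fm k (length bs) (length cs) \<phi> \<psi>) (bs @ cs) \<longleftrightarrow>
           def_set A k \<phi> bs \<subseteq> def_set A k \<psi> cs"
proof -
  have "sat A \<phi> (xs @ bs @ cs) \<longleftrightarrow> sat A \<phi> (xs @ bs)" if "length xs = k" for xs
    using sat_append[of "xs @ bs" \<phi> A cs] that assms(1) by simp
  moreover have "sat A (reindex ([0..<k] @ [k + length bs..<k + length bs + length cs]) \<psi>)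
      (xs @ bs @ cs) \<longleftrightarrow> sat A \<psi> (xs @ cs)" if "length xs = k" for xs
    using that assms(2) map_nth_take[of k "xs @ bs @ cs"] map_nth_shift[of "xs @ bs" cs]
    by (simp add: sat_reindex)
  ultimately show ?thesis by (auto simp: incl_fm_def def_set_def)
qed

text \<open>
  The coordinates are those of an independent subtuple of maximal size of a point that attains
  the dimension.
\<close>

lemma has_dim_projection:
  assumes "has_dim j M U n X d"
  obtains "is" where "length is = d" "set is \<subseteq> {..<n}" "large j M U d (coords is ` X)"
proof -
  obtain \<phi> bs as where \<phi>: "is_fm (n + length bs) \<phi>" "X = def_set M n \<phi> bs"
    and as: "as \<in> def_set U n \<phi> (map j bs)" "rk U as (map j bs) = d"
    using assms unfolding has_dim_def Let_def by blast
  obtain A where A: "A \<subseteq> set as" "acl_indep U (set (map j bs)) A" "card A = d"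
    using rk_attained[of as U "map j bs"] as(2) by auto
  obtain us where us: "set us = A" "distinct us"
    using A(1) finite_distinct_list finite_subset by (metis List.finite_set)
  have "\<forall>u\<in>set us. \<exists>i<n. as ! i = u"
    using A(1) us as(1) by (auto simp: def_set_def in_set_conv_nth subset_iff)
  then obtain f where f: "\<And>u. u \<in> set us \<Longrightarrow> f u < n \<and> as ! f u = u" by metis
  define "is" where "is = map f us"
  have len: "length is = d" using us A(3) distinct_card by (fastforce simp: is_def)
  have is_n: "set is \<subseteq> {..<n}" using f by (auto simp: is_def)
  have "coords is as = us" using f by (auto simp: coords_def is_def intro: map_idI)
  have large: "large j M U d (coords is ` X)"
    unfolding large_def has_dim_def Let_def
  proof (intro exI conjI)
    show "is_fm (d + length bs) (proj_fm n is (length bs) \<phi>)"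
      using is_fm_proj_fm[OF \<phi>(1) is_n] len by simp
    show "coords is ` X = def_set M d (proj_fm n is (length bs) \<phi>) bs"
      using def_set_proj_fm[OF \<phi>(1) is_n] \<phi>(2) len by simp
    have U: "def_set U d (proj_fm n is (length bs) \<phi>) (map j bs) =
        coords is ` def_set U n \<phi> (map j bs)"
      using def_set_proj_fm[of n "map j bs" \<phi> "is" U] \<phi>(1) is_n len by simp
    show "\<forall>r\<in>(\<lambda>as. rk U as (map j bs)) ` def_set U d (proj_fm n is (length bs) \<phi>) (map j bs). r \<le> d"
      using rk_le_length[of U _ "map j bs"] by (auto simp: def_set_def)
    have "us \<in> def_set U d (proj_fm n is (length bs) \<phi>) (map j bs)"
      unfolding U using as(1) \<open>coords is as = us\<close> by blast
    moreover have "rk U us (map j bs) = d"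
    proof (rule antisym)
      show "rk U us (map j bs) \<le> d"
        using rk_le_length[of U us] len by (simp add: is_def)
      show "d \<le> rk U us (map j bs)"
        using rk_ge[of A us U "map j bs"] A us by simp
    qed
    ultimately show "d \<in> (\<lambda>as. rk U as (map j bs)) ` def_set U d (proj_fm n is (length bs) \<phi>) (map j bs)"
      by force
  qed
  show thesis by (rule that[OF len is_n large])
qed

context alg_bounded_monster
begin

lemma large_all: "large j M U n {xs. length xs = n}"
proof -
  obtain us where us: "length us = n" "seq_indep U (range j) us"
    using seq_indep_exists[OF monster] by blast
  have indep: "distinct us" "acl_indep U (range j) (set us)"
    using seq_indep_imp_acl_indep[OF us(2)] by auto
  have "acl_indep U {} (set us)"
    by (rule acl_indep_mono[OF indep(2)]) auto
  then have "n \<le> rk U us []"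
    using rk_ge[of "set us" us U "[]"] indep(1) us(1) by (simp add: distinct_card)
  then have "rk U us [] = n" using rk_le_length[of U us "[]"] us(1) by simp
  moreover have "r \<le> n" if "r \<in> (\<lambda>as. rk U as []) ` {xs. length xs = n}" for r
    using that rk_le_length[of U _ "[]"] by auto
  ultimately show ?thesis
    unfolding large_def has_dim_def Let_def
    using us(1) by (intro exI[of _ "Eq Zero Zero"] exI[of _ "[]"]) (simp add: def_set_def image_iff, blast)
qed

text \<open>
  The dimension of a definable set is at least the dimension of any of its coordinate
  projections, whatever the formulas and parameters that define the sets.  In particular it is
  well-defined and monotone.
\<close>

lemma has_dim_ge:
  assumes "large j M U (length is) Z" "set is \<subseteq> {..<n}" "Z \<subseteq> coords is ` Y" "has_dim j M U n Y d"
  shows "length is \<le> d"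
proof -
  let ?k = "length is"
  obtain \<phi> bs us where \<phi>: "is_fm (?k + length bs) \<phi>" "Z = def_set M ?k \<phi> bs"
    and us: "us \<in> def_set U ?k \<phi> (map j bs)" "rk U us (map j bs) = ?k"
    using assms(1) unfolding large_def has_dim_def Let_def by force
  obtain \<psi> cs where \<psi>: "is_fm (n + length cs) \<psi>" "Y = def_set M n \<psi> cs"
    and d: "\<And>ys. ys \<in> def_set U n \<psi> (map j cs) \<Longrightarrow> rk U ys (map j cs) \<le> d"
    using assms(4) unfolding has_dim_def Let_def by blast
  define \<theta> where "\<theta> = proj_fm n is (length cs) \<psi>"
  have \<theta>: "is_fm (?k + length cs) \<theta>" "def_set M ?k \<theta> cs = coords is ` Y"
    "def_set U ?k \<theta> (map j cs) = coords is ` def_set U n \<psi> (map j cs)"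
    using is_fm_proj_fm[OF \<psi>(1) assms(2)] def_set_proj_fm[OF \<psi>(1) assms(2)] \<psi>(2)
      def_set_proj_fm[of n "map j cs" \<psi> "is" U] \<psi>(1) assms(2) by (simp_all add: \<theta>_def)
  \<comment> \<open>The inclusion of \<open>Z\<close> in the projection of \<open>Y\<close> is first order, so it holds in \<open>U\<close>.\<close>
  have "sat M (incl_fm ?k (length bs) (length cs) \<phi> \<theta>) (bs @ cs)"
    using sat_incl_fm[OF \<phi>(1) \<theta>(1), of M] \<phi>(2) \<theta>(2) assms(3) by simp
  then have "sat U (incl_fm ?k (length bs) (length cs) \<phi> \<theta>) (map j bs @ map j cs)"
    using elementary is_fm_incl_fm[OF \<phi>(1) \<theta>(1)]
    unfolding elementary_embedding_def by (metis length_append map_append)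
  then have incl: "def_set U ?k \<phi> (map j bs) \<subseteq> coords is ` def_set U n \<psi> (map j cs)"
    using sat_incl_fm[of ?k "map j bs" \<phi> "map j cs" \<theta> U] \<phi>(1) \<theta> by simp
  have len: "length us = ?k" using us(1) by (simp add: def_set_def)
  obtain A where A: "A \<subseteq> set us" "acl_indep U (set (map j bs)) A" "card A = ?k"
    using rk_attained[of us U "map j bs"] us(2) by auto
  have "card (set us) = ?k"
    using A(1,3) len card_mono[of "set us" A] card_length[of us] by simp
  then have "distinct us" "set us = A"
    using len A(1,3) card_distinct[of us] card_subset_eq[of "set us" A] by auto
  then have "seq_indep U (set (map j bs)) us"
    using A(2) by (intro acl_indep_imp_seq_indep) auto
  with seq_indep_same_type[OF monster, of "map j bs" us]
  have "\<exists>vs. length vs = length us \<and> seq_indep U (range j) vs \<and>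
      (\<forall>\<phi>. is_fm (length us + length (map j bs)) \<phi> \<longrightarrow>
        sat U \<phi> (us @ map j bs) \<longleftrightarrow> sat U \<phi> (vs @ map j bs))" by fastforce
  then obtain vs where "length vs = length us \<and> seq_indep U (range j) vs \<and>
      (\<forall>\<phi>. is_fm (length us + length (map j bs)) \<phi> \<longrightarrow>
        sat U \<phi> (us @ map j bs) \<longleftrightarrow> sat U \<phi> (vs @ map j bs))" ..
  then have vs: "length vs = ?k" "seq_indep U (range j) vs"
    "\<And>\<phi>. is_fm (?k + length bs) \<phi> \<Longrightarrow> sat U \<phi> (us @ map j bs) \<longleftrightarrow> sat U \<phi> (vs @ map j bs)"
    using len by simp_all
  have "vs \<in> def_set U ?k \<phi> (map j bs)"
    using vs \<phi>(1) us(1) by (simp add: def_set_def)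
  then obtain ys where ys: "ys \<in> def_set U n \<psi> (map j cs)" "vs = coords is ys"
    using incl by blast
  have indep: "distinct vs" "acl_indep U (range j) (set vs)"
    using seq_indep_imp_acl_indep[OF vs(2)] by auto
  have "set vs \<subseteq> set ys"
    using ys assms(2) by (auto simp: coords_def def_set_def subset_iff)
  moreover have "acl_indep U (set (map j cs)) (set vs)"
    by (rule acl_indep_mono[OF indep(2)]) auto
  ultimately have "card (set vs) \<le> rk U ys (map j cs)" by (rule rk_ge)
  then show ?thesis using d[OF ys(1)] indep(1) vs(1) by (simp add: distinct_card)
qed

end


section \<open>Derivations of polynomial values\<close>

definition mon_eval :: "(nat \<Rightarrow>\<^sub>0 nat) \<Rightarrow> 'a::comm_ring_1 list \<Rightarrow> 'a" where
  "mon_eval m xs = (\<Prod>i\<in>Poly_Mapping.keys m. xs ! i ^ Poly_Mapping.lookup m i)"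

lemma mon_eval_eq_prod_below:
  assumes "Poly_Mapping.keys m \<subseteq> {..<n}"
  shows "mon_eval m xs = (\<Prod>i<n. xs ! i ^ Poly_Mapping.lookup m i)"
  unfolding mon_eval_def using assms by (intro prod.mono_neutral_left) (auto simp: in_keys_iff)

lemma mpol_eval_eq_sum_mon:
  "mpol_eval p xs = (\<Sum>m\<in>Poly_Mapping.keys p. Poly_Mapping.lookup p m * mon_eval m xs)"
  by (simp add: mpol_eval_def mpol_subst_def mon_eval_def)

lemma mpol_eval_add: "mpol_eval (p + q) xs = mpol_eval p xs + mpol_eval q xs"
proof -
  let ?S = "Poly_Mapping.keys p \<union> Poly_Mapping.keys q"
  have "Poly_Mapping.keys (p + q) \<subseteq> ?S" by (rule Poly_Mapping.keys_add)
  then show ?thesis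
    by (simp add: mpol_eval_sum[of ?S p] mpol_eval_sum[of ?S q] mpol_eval_sum[of ?S "p + q"]
        lookup_add sum.distrib distrib_right)
qed

lemma mpol_eval_0: "mpol_eval 0 xs = 0"
  by (simp add: mpol_eval_def mpol_subst_def)

lemma mpol_eval_of_sum: "mpol_eval (\<Sum>a\<in>A. p a) xs = (\<Sum>a\<in>A. mpol_eval (p a) xs)"
  by (induction A rule: infinite_finite_induct) (auto simp: mpol_eval_0 mpol_eval_add)

lemma mpol_eval_single: "mpol_eval (Poly_Mapping.single m a) xs = a * mon_eval m xs"
  by (cases "a = 0") (auto simp: mpol_eval_eq_sum_mon)

lemma mpol_eval_map:
  "mpol_eval (mpol_map \<epsilon> p) xs = (\<Sum>m\<in>Poly_Mapping.keys p. \<epsilon> (Poly_Mapping.lookup p m) * mon_eval m xs)"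
  by (simp add: mpol_map_def mpol_eval_of_sum mpol_eval_single)

lemma mpol_eval_pderiv:
  "mpol_eval (mpol_pderiv i p) xs = (\<Sum>m\<in>Poly_Mapping.keys p. of_nat (Poly_Mapping.lookup m i) *
     Poly_Mapping.lookup p m * mon_eval (m - Poly_Mapping.single i 1) xs)"
  by (simp add: mpol_pderiv_def mpol_eval_of_sum mpol_eval_single)

lemma keys_minus_subset:
  fixes m :: "nat \<Rightarrow>\<^sub>0 nat"
  shows "Poly_Mapping.keys (m - k) \<subseteq> Poly_Mapping.keys m"
  by (auto simp: in_keys_iff lookup_minus)

lemma vars_below_sum_single:
  assumes "\<And>a. a \<in> A \<Longrightarrow> Poly_Mapping.keys (m a) \<subseteq> {..<n}"
  shows "(\<Sum>a\<in>A. Poly_Mapping.single (m a) (c a)) \<in> mpol_vars_below n"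
proof -
  have "Poly_Mapping.keys (\<Sum>a\<in>A. Poly_Mapping.single (m a) (c a)) \<subseteq> m ` A"
    by (rule order_trans[OF keys_sum]) auto
  then show ?thesis using assms by (auto simp: mpol_vars_below_def subset_iff image_iff)
qed

lemma vars_below_map: "p \<in> mpol_vars_below n \<Longrightarrow> mpol_map \<epsilon> p \<in> mpol_vars_below n"
  unfolding mpol_map_def by (rule vars_below_sum_single) (auto simp: mpol_vars_below_def)

lemma vars_below_pderiv: "p \<in> mpol_vars_below n \<Longrightarrow> mpol_pderiv i p \<in> mpol_vars_below n"
  unfolding mpol_pderiv_def
  by (rule vars_below_sum_single, rule order_trans[OF keys_minus_subset])
     (auto simp: mpol_vars_below_def)

context
  fixes \<delta> :: "'a::field \<Rightarrow> 'a"
  assumes derivation: "derivation_on UNIV \<delta>"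
begin

lemma derivation_add: "\<delta> (x + y) = \<delta> x + \<delta> y"
  and derivation_mult: "\<delta> (x * y) = \<delta> x * y + x * \<delta> y"
  using derivation by (auto simp: derivation_on_def)

lemma derivation_0: "\<delta> 0 = 0"
proof -
  have "\<delta> 0 + \<delta> 0 = \<delta> 0 + 0" using derivation_add[of 0 0] by (simp only: add_0_right)
  then show ?thesis by (simp only: add_left_cancel)
qed

lemma derivation_1: "\<delta> 1 = 0"
proof -
  have "\<delta> 1 + \<delta> 1 = \<delta> 1 + 0"
    using derivation_mult[of 1 1] by (simp only: mult_1_left mult_1_right add_0_right)
  then show ?thesis by (simp only: add_left_cancel)
qed

lemma derivation_sum: "\<delta> (\<Sum>i\<in>I. f i) = (\<Sum>i\<in>I. \<delta> (f i))"
  by (induction I rule: infinite_finite_induct) (auto simp: derivation_0 derivation_add)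

lemma derivation_power: "\<delta> (x ^ k) = of_nat k * x ^ (k - 1) * \<delta> x"
proof (induction k)
  case (Suc k)
  have "x * (of_nat k * x ^ (k - 1) * \<delta> x) = of_nat k * x ^ k * \<delta> x"
    by (cases k) (simp_all add: algebra_simps)
  then show ?case
    by (simp only: power_Suc derivation_mult Suc) (simp add: algebra_simps)
qed (simp add: derivation_1)

lemma derivation_prod:
  "finite I \<Longrightarrow> \<delta> (\<Prod>i\<in>I. f i) = (\<Sum>i\<in>I. \<delta> (f i) * (\<Prod>l\<in>I - {i}. f l))"
proof (induction I rule: finite_induct)
  case (insert a I)
  have "insert a I - {i} = insert a (I - {i})" if "i \<in> I" for i
    using insert that by auto
  then have "(\<Sum>i\<in>I. \<delta> (f i) * (\<Prod>l\<in>insert a I - {i}. f l)) =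
      (\<Sum>i\<in>I. f a * (\<delta> (f i) * (\<Prod>l\<in>I - {i}. f l)))"
    using insert by (intro sum.cong) auto
  then show ?case
    using insert by (simp add: derivation_mult sum_distrib_left)
qed (simp add: derivation_1)

lemma derivation_mon_eval:
  assumes "Poly_Mapping.keys m \<subseteq> {..<n}"
  shows "\<delta> (mon_eval m xs) = (\<Sum>i<n. of_nat (Poly_Mapping.lookup m i) *
           mon_eval (m - Poly_Mapping.single i 1) xs * \<delta> (xs ! i))"
proof -
  let ?f = "\<lambda>i. xs ! i ^ Poly_Mapping.lookup m i"
  have "\<delta> (?f i) * (\<Prod>l\<in>{..<n} - {i}. ?f l) =
      of_nat (Poly_Mapping.lookup m i) * mon_eval (m - Poly_Mapping.single i 1) xs * \<delta> (xs ! i)"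
    if "i < n" for i
  proof -
    have "mon_eval (m - Poly_Mapping.single i 1) xs =
        (\<Prod>l<n. xs ! l ^ Poly_Mapping.lookup (m - Poly_Mapping.single i 1) l)"
      using assms keys_minus_subset by (intro mon_eval_eq_prod_below) blast
    also have "\<dots> = xs ! i ^ (Poly_Mapping.lookup m i - 1) * (\<Prod>l\<in>{..<n} - {i}. ?f l)"
      using that by (subst prod.remove[of _ i]) (auto simp: lookup_minus lookup_single intro!: prod.cong)
    finally show ?thesis by (simp add: derivation_power)
  qed
  then show ?thesis
    unfolding mon_eval_eq_prod_below[OF assms] by (subst derivation_prod) (auto intro!: sum.cong)
qed

text \<open>
  The chain rule, by which \<open>\<delta> c\<close> lies in the prolonged tangent space at \<open>c\<close> for every zero \<open>c\<close>.
\<close>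

lemma derivation_mpol_eval:
  assumes "p \<in> mpol_vars_below n" "length xs = n"
  shows "\<delta> (mpol_eval p xs) = prolong \<delta> n p xs (map \<delta> xs)"
proof -
  have "\<delta> (mon_eval m xs) = (\<Sum>i<n. of_nat (Poly_Mapping.lookup m i) *
      mon_eval (m - Poly_Mapping.single i 1) xs * \<delta> (xs ! i))" if "m \<in> Poly_Mapping.keys p" for m
    using that assms(1) by (intro derivation_mon_eval) (auto simp: mpol_vars_below_def)
  then have "\<delta> (mpol_eval p xs) = mpol_eval (mpol_map \<delta> p) xs +
      (\<Sum>m\<in>Poly_Mapping.keys p. \<Sum>i<n. of_nat (Poly_Mapping.lookup m i) * Poly_Mapping.lookup p m *
         mon_eval (m - Poly_Mapping.single i 1) xs * \<delta> (xs ! i))"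
    by (simp add: mpol_eval_eq_sum_mon[of p] mpol_eval_map derivation_sum derivation_mult
        sum.distrib sum_distrib_left mult.assoc mult.left_commute)
  also have "(\<Sum>m\<in>Poly_Mapping.keys p. \<Sum>i<n. of_nat (Poly_Mapping.lookup m i) *
         Poly_Mapping.lookup p m * mon_eval (m - Poly_Mapping.single i 1) xs * \<delta> (xs ! i)) =
      (\<Sum>i<n. mpol_eval (mpol_pderiv i p) xs * map \<delta> xs ! i)"
    using assms(2) by (subst sum.swap) (simp add: mpol_eval_pderiv sum_distrib_right)
  finally show ?thesis by (simp add: prolong_def)
qed

end

lemma prolong_zero: "prolong (\<lambda>_. 0) n p xs ys = (\<Sum>i<n. mpol_eval (mpol_pderiv i p) xs * ys ! i)"
  by (simp add: prolong_def mpol_eval_map)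

lemma polyfun_prolong:
  assumes "p \<in> mpol_vars_below n"
  shows "polyfun UNIV (n + n) (\<lambda>zs. prolong \<epsilon> n p (take n zs) (drop n zs))"
proof -
  have eval: "polyfun UNIV (n + n) (\<lambda>zs. mpol_eval q (take n zs))" if "q \<in> mpol_vars_below n"
    for q :: "'a mpol"
  proof -
    have "polyfun UNIV (n + n) (\<lambda>zs. mpol_eval q (map (\<lambda>c. c zs) (map (\<lambda>i zs. zs ! i) [0..<n])))"
      by (intro polyfun_comp[OF polyfun_mpol_eval[OF that]]) (auto intro: polyfun.coord)
    then show ?thesis
      by (rule polyfun.cong) (simp add: comp_def map_nth_take)
  qed
  have "polyfun UNIV (n + n) (\<lambda>zs. mpol_eval (mpol_map \<epsilon> p) (take n zs) +
      (\<Sum>i<n. mpol_eval (mpol_pderiv i p) (take n zs) * zs ! (n + i)))"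
    by (intro polyfun.add polyfun_sum polyfun.mult eval vars_below_map vars_below_pderiv assms
        polyfun.coord) auto
  then show ?thesis
    by (rule polyfun.cong) (auto simp: prolong_def)
qed

section \<open>Definable relations\<close>

text \<open>
  Definability with a fixed list of parameters, common to all relations that are combined.  The
  bound tuple is put in front of the free one, and \<^const>\<open>coords\<close> rearranges them.
\<close>

definition def_rel ::
  "('f::arity, 'r::arity, 'a::field) struc \<Rightarrow> 'a list \<Rightarrow> nat \<Rightarrow> ('a list \<Rightarrow> bool) \<Rightarrow> bool" where
  "def_rel M bs n R \<longleftrightarrow> (\<exists>\<phi>. is_fm (n + length bs) \<phi> \<and>
     (\<forall>xs. length xs = n \<longrightarrow> (R xs \<longleftrightarrow> sat M \<phi> (xs @ bs))))"

lemma def_rel_cong: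
  "def_rel M bs n R \<Longrightarrow> (\<And>xs. length xs = n \<Longrightarrow> R xs \<longleftrightarrow> S xs) \<Longrightarrow> def_rel M bs n S"
  unfolding def_rel_def by auto

lemma def_rel_Not: "def_rel M bs n R \<Longrightarrow> def_rel M bs n (\<lambda>xs. \<not> R xs)"
  unfolding def_rel_def by (metis is_fm.simps(3) sat.simps(3))

lemma def_rel_And:
  "def_rel M bs n R \<Longrightarrow> def_rel M bs n S \<Longrightarrow> def_rel M bs n (\<lambda>xs. R xs \<and> S xs)"
  unfolding def_rel_def by (metis is_fm.simps(4) sat.simps(4))

lemma def_rel_Imp:
  "def_rel M bs n R \<Longrightarrow> def_rel M bs n S \<Longrightarrow> def_rel M bs n (\<lambda>xs. R xs \<longrightarrow> S xs)"
  unfolding def_rel_def by (metis is_fm_combinators(1) sat_combinators(1))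

lemma def_rel_True: "def_rel M bs n (\<lambda>_. True)"
  unfolding def_rel_def by (intro exI[of _ "Eq Zero Zero"]) simp

lemma def_rel_Ball:
  "(\<And>p. p \<in> set ps \<Longrightarrow> def_rel M bs n (R p)) \<Longrightarrow> def_rel M bs n (\<lambda>xs. \<forall>p\<in>set ps. R p xs)"
  by (induction ps) (auto intro: def_rel_True def_rel_And)

lemma def_rel_Ex:
  assumes "def_rel M bs (k + n) R"
  shows "def_rel M bs n (\<lambda>xs. \<exists>ys. length ys = k \<and> R (ys @ xs))"
proof -
  obtain \<phi> where \<phi>: "is_fm (k + n + length bs) \<phi>"
    "\<And>xs. length xs = k + n \<Longrightarrow> R xs \<longleftrightarrow> sat M \<phi> (xs @ bs)"
    using assms unfolding def_rel_def by blast
  show ?thesis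
    unfolding def_rel_def using \<phi> by (intro exI[of _ "ExN k \<phi>"]) (auto simp: add.assoc)
qed

lemma def_rel_All:
  assumes "def_rel M bs (k + n) R"
  shows "def_rel M bs n (\<lambda>xs. \<forall>ys. length ys = k \<longrightarrow> R (ys @ xs))"
  using def_rel_Not[OF def_rel_Ex[OF def_rel_Not[OF assms]]] by simp

lemma def_rel_coords:
  assumes "def_rel M bs (length is) R" "set is \<subseteq> {..<n}"
  shows "def_rel M bs n (\<lambda>xs. R (coords is xs))"
proof -
  obtain \<phi> where \<phi>: "is_fm (length is + length bs) \<phi>"
    "\<And>xs. length xs = length is \<Longrightarrow> R xs \<longleftrightarrow> sat M \<phi> (xs @ bs)"
    using assms(1) unfolding def_rel_def by blast
  let ?r = "is @ [n..<n + length bs]"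
  have "map ((!) (xs @ bs)) ?r = coords is xs @ bs" if "length xs = n" for xs
    using that assms(2) map_nth_shift[of xs bs] by (auto simp: coords_def nth_append subset_iff)
  then have "sat M (reindex ?r \<phi>) (xs @ bs) \<longleftrightarrow> R (coords is xs)" if "length xs = n" for xs
    using that \<phi> by (subst sat_reindex) (auto simp: coords_def simp del: map_append)
  then show ?thesis
    unfolding def_rel_def using \<phi>(1) assms(2)
    by (intro exI[of _ "reindex ?r \<phi>"]) (auto intro!: is_fm_reindex)
qed

lemma def_rel_eq_coords:
  assumes "length is = length js" "set is \<subseteq> {..<n}" "set js \<subseteq> {..<n}"
  shows "def_rel M bs n (\<lambda>xs. coords is xs = coords js xs)"
proof -
  have "map ((!) (xs @ bs)) is = coords is xs" if "set is \<subseteq> {..<length xs}" for "is" and xs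
    using that by (auto simp: coords_def nth_append subset_iff)
  then show ?thesis
    unfolding def_rel_def using assms
    by (intro exI[of _ "eqs is js"]) (auto intro!: is_fm_eqs)
qed

lemma def_rel_polyfun:
  fixes M :: "('f::arity, 'r::arity, 'a::field) struc"
  assumes "polyfun (set bs) n f"
  shows "def_rel M bs n (\<lambda>xs. f xs = 0)"
proof -
  obtain t where "is_tm (n + length bs) t"
    "\<And>xs. length xs = n \<Longrightarrow> eval_tm M t (xs @ bs) = f xs"
    using polyfun_tm[OF assms, of M] by blast
  then show ?thesis
    unfolding def_rel_def by (intro exI[of _ "Eq t Zero"]) auto
qed

lemma definable_imp_def_rel:
  assumes "definable M n X"
  obtains bs where "\<And>cs. def_rel M (bs @ cs) n (\<lambda>xs. xs \<in> X)"
proof -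
  obtain \<phi> bs where \<phi>: "is_fm (n + length bs) \<phi>" "X = def_set M n \<phi> bs"
    using assms unfolding definable_def by blast
  have "def_rel M (bs @ cs) n (\<lambda>xs. xs \<in> X)" for cs
  proof -
    have "sat M \<phi> (xs @ bs @ cs) \<longleftrightarrow> sat M \<phi> (xs @ bs)" if "length xs = n" for xs
      using sat_append[of "xs @ bs" \<phi> M cs] \<phi>(1) that by simp
    then show ?thesis
      unfolding def_rel_def using \<phi>
      by (intro exI[of _ \<phi>]) (auto simp: def_set_def intro: is_fm_mono)
  qed
  then show thesis by (rule that)
qed

lemma def_rel_imp_definable: "def_rel M bs n R \<Longrightarrow> definable M n {xs. length xs = n \<and> R xs}"
  unfolding def_rel_def definable_def def_set_def by blast

lemma coords_append [simp]: "coords (is @ js) xs = coords is xs @ coords js xs"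
  by (simp add: coords_def)

lemma coords_upt: "k \<le> length xs \<Longrightarrow> coords [i..<k] xs = take (k - i) (drop i xs)"
  by (rule nth_equalityI) (auto simp: coords_def)

lemma coords_append_left: "set is \<subseteq> {..<length xs} \<Longrightarrow> coords is (xs @ ys) = coords is xs"
  by (auto simp: coords_def nth_append subset_iff)

lemma length_coords [simp]: "length (coords is xs) = length is"
  by (simp add: coords_def)


section \<open>Genericity and the prolongation scheme\<close>

lemma tau_at_zero_combination:
  assumes "v \<in> tau_at (\<lambda>_. 0) n ps c" "v' \<in> tau_at (\<lambda>_. 0) n ps c"
  shows "map (\<lambda>i. v ! i + s * v' ! i) [0..<n] \<in> tau_at (\<lambda>_. 0) n ps c"
proof -
  have "prolong (\<lambda>_. 0) n p c (map (\<lambda>i. v ! i + s * v' ! i) [0..<n]) =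
      prolong (\<lambda>_. 0) n p c v + s * prolong (\<lambda>_. 0) n p c v'" for p
    by (simp add: prolong_zero sum_distrib_left sum.distrib algebra_simps)
  then show ?thesis using assms by (simp add: tau_at_def)
qed

lemma tau_at_diff:
  assumes "y \<in> tau_at \<epsilon> n ps c" "y' \<in> tau_at \<epsilon> n ps c"
  shows "map (\<lambda>i. y ! i - y' ! i) [0..<n] \<in> tau_at (\<lambda>_. 0) n ps c"
proof -
  have "prolong (\<lambda>_. 0) n p c (map (\<lambda>i. y ! i - y' ! i) [0..<n]) =
      prolong \<epsilon> n p c y - prolong \<epsilon> n p c y'" for p
    by (simp add: prolong_zero prolong_def sum_subtractf algebra_simps)
  then show ?thesis using assms by (simp add: tau_at_def)
qed

lemma derivation_in_tau_at:
  assumes "derivation_on UNIV \<delta>" "set ps \<subseteq> mpol_vars_below n" "c \<in> zeros n ps"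
  shows "map \<delta> c \<in> tau_at \<delta> n ps c"
proof -
  have "prolong \<delta> n p c (map \<delta> c) = 0" if "p \<in> set ps" for p
    using derivation_mpol_eval[OF assms(1), of p n c] derivation_0[OF assms(1)] assms(2,3) that
    by (auto simp: zeros_def)
  then show ?thesis using assms(3) by (simp add: tau_at_def zeros_def)
qed

lemma split_list_at:
  assumes "length zs = a + b"
  obtains xs ys where "zs = xs @ ys" "length xs = a" "length ys = b"
  using assms that[of "take a zs" "drop a zs"] by simp

context alg_bounded_monster
begin

text \<open>
  A linear space that has dimension at most \<open>e\<close> as a definable set and projects onto \<open>M\<^sup>e\<close> has no
  nonzero element \<open>v\<close> in the kernel of the projection: with a coordinate \<open>k\<close> such that
  \<open>v ! k \<noteq> 0\<close> it would even project onto \<open>M\<^sup>e\<^sup>+\<^sup>1\<close>.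
\<close>

lemma tangent_projection_inj:
  assumes "set is \<subseteq> {..<n}" "has_dim j M U n (tau_at (\<lambda>_. 0) n ps c) d" "d \<le> length is"
    and surj: "\<And>w. length w = length is \<Longrightarrow> \<exists>v\<in>tau_at (\<lambda>_. 0) n ps c. coords is v = w"
    and v: "v \<in> tau_at (\<lambda>_. 0) n ps c" "\<And>i. i \<in> set is \<Longrightarrow> v ! i = 0" and "k < n"
  shows "v ! k = 0"
proof (rule ccontr)
  assume vk: "v ! k \<noteq> 0"
  let ?V = "tau_at (\<lambda>_. 0) n ps c"
  have "{xs. length xs = length (is @ [k])} \<subseteq> coords (is @ [k]) ` ?V"
  proof
    fix xs :: "'m list" assume "xs \<in> {xs. length xs = length (is @ [k])}"
    then obtain w t where xs: "xs = w @ [t]" "length w = length is"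
      by (cases xs rule: rev_cases) auto
    obtain v1 where v1: "v1 \<in> ?V" "coords is v1 = w" using surj xs(2) by blast
    define v2 where "v2 = map (\<lambda>i. v1 ! i + ((t - v1 ! k) / v ! k) * v ! i) [0..<n]"
    have "v2 \<in> ?V" unfolding v2_def using v1(1) v(1) by (rule tau_at_zero_combination)
    moreover have "v2 ! i = v1 ! i" if "i \<in> set is" for i
      using that assms(1) v(2) by (auto simp: v2_def subset_iff)
    then have "coords is v2 = w" using v1(2) by (auto simp: coords_def)
    moreover have "v2 ! k = t" using vk \<open>k < n\<close> by (simp add: v2_def)
    then have "coords [k] v2 = [t]" by (simp add: coords_def)
    ultimately show "xs \<in> coords (is @ [k]) ` ?V" using xs(1) by force
  qed
  moreover have "set (is @ [k]) \<subseteq> {..<n}" using assms(1) \<open>k < n\<close> by simp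
  ultimately have "length (is @ [k]) \<le> d"
    using has_dim_ge[OF large_all _ _ assms(2)] by blast
  then show False using assms(3) by simp
qed

text \<open>
  The scheme is applied to the empty system of equations, for which all points are regular.
\<close>

lemma PP_imp_generic:
  assumes "PP_scheme j M U \<delta>"
  shows "generic_scheme j M U \<delta>"
  unfolding generic_scheme_def
proof (intro allI impI)
  fix n W
  assume W: "definable M (2 * n) W" "large j M U n (take n ` W)"
  have len: "length xs = 2 * n" if "xs \<in> W" for xs
    using W(1) that by (auto simp: definable_def def_set_def)
  have "W \<subseteq> tau \<delta> n []"
  proof
    fix xs assume "xs \<in> W"
    then have "xs = take n xs @ drop n xs" "length (take n xs) = n" "length (drop n xs) = n"
      using len by auto
    then show "xs \<in> tau \<delta> n []"
      unfolding tau_def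
      by (intro CollectI exI[of _ "take n xs"] exI[of _ "drop n xs"]) (simp add: zeros_def tau_at_def)
  qed
  moreover have dim: "has_dim j M U n {xs. length xs = n} n"
    using large_all by (simp add: large_def)
  then have "take n ` W \<subseteq> Reg j M U n []"
    using len by (auto simp: Reg_def zeros_def tau_at_def)
  moreover have "\<exists>e. has_dim j M U n (take n ` W) e \<and> has_dim j M U n (zeros n []) e"
    using W(2) dim by (auto simp: large_def zeros_def)
  ultimately show "\<exists>cs. length cs = n \<and> cs @ map \<delta> cs \<in> W"
    using assms[unfolded PP_scheme_def, rule_format, of "[]" 0 n 0 W] W(1) by simp
qed

text \<open>
  Genericity is used once, for a set \<open>W\<close> that serves two purposes.  If \<open>coords is\<close> does not map
  the prolonged tangent space at \<open>x\<close> onto \<open>M\<^sup>e\<close>, then \<open>x\<close> contributes to \<open>W\<close> the points outside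
  the image, which \<open>\<delta>\<close> cannot meet; otherwise it contributes the image of the fibre of \<open>X\<close>.
\<close>

lemma generic_imp_PP:
  assumes der: "derivation_on UNIV \<delta>" and gen: "generic_scheme j M U \<delta>"
  shows "PP_scheme j M U \<delta>"
  unfolding PP_scheme_def
proof (intro allI impI)
  fix m n d :: nat and ps X
  assume ps: "set ps \<subseteq> mpol_vars_below n \<inter> mpol_deg_le d"
    and X: "definable M (2 * n) X" "X \<subseteq> tau \<delta> n ps" "take n ` X \<subseteq> Reg j M U n ps"
    and "\<exists>e. has_dim j M U n (take n ` X) e \<and> has_dim j M U n (zeros n ps) e"
  then obtain e where e: "has_dim j M U n (take n ` X) e" "has_dim j M U n (zeros n ps) e"
    by blast
  obtain "is" where "is": "length is = e" "set is \<subseteq> {..<n}" "large j M U e (coords is ` take n ` X)"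
    using has_dim_projection[OF e(1)] by blast
  have lenX: "length xs = 2 * n" if "xs \<in> X" for xs
    using X(1) that by (auto simp: definable_def def_set_def)

  \<comment> \<open>\<open>T x\<close> is the image of the prolonged tangent space at \<open>x\<close>, and \<open>S x\<close> is that of the fibre of \<open>X\<close>.\<close>
  define T where "T x w \<longleftrightarrow> (\<exists>y. length y = n \<and> y \<in> tau_at \<delta> n ps x \<and> coords is y = w)" for x w
  define S where "S x w \<longleftrightarrow> (\<exists>y. length y = n \<and> x @ y \<in> X \<and> coords is y = w)" for x w
  define R where "R zs \<longleftrightarrow> (\<exists>x. length x = n \<and> (\<exists>y. length y = n \<and> x @ y \<in> X) \<and>
      coords is x = take e zs \<and>
      (T x (drop e zs) \<longrightarrow> (\<forall>w. length w = e \<longrightarrow> T x w) \<and> S x (drop e zs)))" for zs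
  define W where "W = {zs. length zs = 2 * e \<and> R zs}"

  have "definable M (2 * e) W"
  proof -
    obtain bs0 where bs0: "\<And>cs. def_rel M (bs0 @ cs) (n + n) (\<lambda>xs. xs \<in> X)"
      using definable_imp_def_rel[OF X(1)] by (auto simp: mult_2)
    define g where "g p = (\<lambda>zs. prolong \<delta> n p (take n zs) (drop n zs))" for p
    have g: "polyfun UNIV (n + n) f" if "f \<in> g ` set ps" for f
      using that ps polyfun_prolong by (auto simp: g_def)
    have "\<exists>cs. set cs \<subseteq> UNIV \<and> (\<forall>f\<in>g ` set ps. polyfun (set cs) (n + n) f)"
      by (rule polyfuns_finite_params[OF _ g]) auto
    then obtain cs where cs: "\<forall>f\<in>g ` set ps. polyfun (set cs) (n + n) f" by (elim exE conjE)
    define bs where "bs = bs0 @ cs"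
    have X_rel: "def_rel M bs (n + n) (\<lambda>xs. xs \<in> X)" using bs0 by (simp add: bs_def)
    have g_rel: "def_rel M bs (n + n) (\<lambda>xs. g p xs = 0)" if "p \<in> set ps" for p
      by (rule def_rel_polyfun, rule polyfun_mono[of "set cs"]) (use cs that in \<open>auto simp: bs_def\<close>)

    \<comment> \<open>The environments are \<open>y @ x @ w\<close> with \<open>y\<close> bound; \<open>?xy\<close> extracts \<open>x @ y\<close>.\<close>
    let ?xy = "[n..<n + n] @ [0..<n]"
    have X_lift: "def_rel M bs (n + (n + k)) (\<lambda>z. coords ?xy z \<in> X)" for k
      using X_rel by (intro def_rel_coords) auto
    have eq_lift: "def_rel M bs (n + (n + e)) (\<lambda>z. coords is z = coords [n + n..<n + n + e] z)"
      using "is" by (intro def_rel_eq_coords) auto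
    have swap: "coords ?xy (y @ x @ w) = x @ y" if "length x = n" "length y = n" for x y w :: "'m list"
      using that by (simp add: coords_upt)
    have isy: "coords is (y @ z) = coords is y" if "length y = n" for y z :: "'m list"
      using that "is"(2) by (intro coords_append_left) auto
    have T_rel: "def_rel M bs (n + e) (\<lambda>z. T (take n z) (drop n z))"
    proof (rule def_rel_cong)
      show "def_rel M bs (n + e) (\<lambda>z. \<exists>y. length y = n \<and> ((\<forall>p\<in>set ps. g p (coords ?xy (y @ z)) = 0) \<and>
          coords is (y @ z) = coords [n + n..<n + n + e] (y @ z)))"
      proof (intro def_rel_Ex def_rel_And def_rel_Ball eq_lift)
        fix p assume "p \<in> set ps"
        then show "def_rel M bs (n + (n + e)) (\<lambda>z. g p (coords ?xy z) = 0)"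
          using g_rel by (intro def_rel_coords[where R = "\<lambda>xs. g p xs = 0"]) auto
      qed
      fix z :: "'m list" assume "length z = n + e"
      then obtain x w where z: "z = x @ w" "length x = n" "length w = e"
        by (rule split_list_at)
      then show "(\<exists>y. length y = n \<and> ((\<forall>p\<in>set ps. g p (coords ?xy (y @ z)) = 0) \<and>
          coords is (y @ z) = coords [n + n..<n + n + e] (y @ z))) \<longleftrightarrow> T (take n z) (drop n z)"
        using swap isy by (auto simp: T_def tau_at_def g_def coords_upt simp del: coords_append)
    qed
    have S_rel: "def_rel M bs (n + e) (\<lambda>z. S (take n z) (drop n z))"
    proof (rule def_rel_cong)
      show "def_rel M bs (n + e) (\<lambda>z. \<exists>y. length y = n \<and> (coords ?xy (y @ z) \<in> X \<and>
          coords is (y @ z) = coords [n + n..<n + n + e] (y @ z)))"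
        by (intro def_rel_Ex def_rel_And X_lift eq_lift)
      fix z :: "'m list" assume "length z = n + e"
      then obtain x w where z: "z = x @ w" "length x = n" "length w = e"
        by (rule split_list_at)
      then show "(\<exists>y. length y = n \<and> (coords ?xy (y @ z) \<in> X \<and>
          coords is (y @ z) = coords [n + n..<n + n + e] (y @ z))) \<longleftrightarrow> S (take n z) (drop n z)"
        using swap isy by (auto simp: S_def coords_upt simp del: coords_append)
    qed
    have X_proj: "def_rel M bs n (\<lambda>x. \<exists>y. length y = n \<and> x @ y \<in> X)"
    proof (rule def_rel_cong)
      show "def_rel M bs n (\<lambda>x. \<exists>y. length y = n \<and> coords ?xy (y @ x) \<in> X)"
        using X_lift[of 0] by (intro def_rel_Ex) simp
      fix x :: "'m list" assume "length x = n"
      then show "(\<exists>y. length y = n \<and> coords ?xy (y @ x) \<in> X) \<longleftrightarrow> (\<exists>y. length y = n \<and> x @ y \<in> X)"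
        using swap[of x _ "[]"] by (auto simp del: coords_append)
    qed
    have T_all: "def_rel M bs n (\<lambda>x. \<forall>w. length w = e \<longrightarrow> T x w)"
    proof (rule def_rel_cong)
      show "def_rel M bs n (\<lambda>x. \<forall>w. length w = e \<longrightarrow>
          T (take n (coords ([e..<e + n] @ [0..<e]) (w @ x))) (drop n (coords ([e..<e + n] @ [0..<e]) (w @ x))))"
        using T_rel
        by (intro def_rel_All def_rel_coords[where R = "\<lambda>z. T (take n z) (drop n z)"]) auto
    qed (simp add: coords_upt)
    have "def_rel M bs (e + e) (\<lambda>zs. \<exists>x. length x = n \<and>
        ((\<lambda>x. \<exists>y. length y = n \<and> x @ y \<in> X) (coords [0..<n] (x @ zs)) \<and>
         coords is (x @ zs) = coords [n..<n + e] (x @ zs) \<and>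
         ((\<lambda>z. T (take n z) (drop n z)) (coords ([0..<n] @ [n + e..<n + e + e]) (x @ zs)) \<longrightarrow>
          (\<lambda>x. \<forall>w. length w = e \<longrightarrow> T x w) (coords [0..<n] (x @ zs)) \<and>
          (\<lambda>z. S (take n z) (drop n z)) (coords ([0..<n] @ [n + e..<n + e + e]) (x @ zs)))))"
      using X_proj T_all T_rel S_rel "is"
      by (intro def_rel_Ex def_rel_And def_rel_Imp
          def_rel_coords[where R = "\<lambda>x. \<exists>y. length y = n \<and> x @ y \<in> X"]
          def_rel_coords[where R = "\<lambda>x. \<forall>w. length w = e \<longrightarrow> T x w"]
          def_rel_coords[where R = "\<lambda>z. T (take n z) (drop n z)"]
          def_rel_coords[where R = "\<lambda>z. S (take n z) (drop n z)"] def_rel_eq_coords) auto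
    then have "def_rel M bs (e + e) R"
    proof (rule def_rel_cong)
      fix zs :: "'m list" assume "length zs = e + e"
      then obtain x' w where zs: "zs = x' @ w" "length x' = e" "length w = e"
        by (rule split_list_at)
      then show "(\<exists>x. length x = n \<and>
        ((\<lambda>x. \<exists>y. length y = n \<and> x @ y \<in> X) (coords [0..<n] (x @ zs)) \<and>
         coords is (x @ zs) = coords [n..<n + e] (x @ zs) \<and>
         ((\<lambda>z. T (take n z) (drop n z)) (coords ([0..<n] @ [n + e..<n + e + e]) (x @ zs)) \<longrightarrow>
          (\<lambda>x. \<forall>w. length w = e \<longrightarrow> T x w) (coords [0..<n] (x @ zs)) \<and>
          (\<lambda>z. S (take n z) (drop n z)) (coords ([0..<n] @ [n + e..<n + e + e]) (x @ zs))))) \<longleftrightarrow> R zs"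
        unfolding R_def using isy by (intro ex_cong1 conj_cong refl) (simp_all add: coords_upt)
    qed
    then show ?thesis
      using def_rel_imp_definable[of M bs "e + e" R] by (simp add: W_def mult_2)
  qed

  \<comment> \<open>For each \<open>x\<close> there is a suitable \<open>w\<close>: one outside \<open>T x\<close> if possible, otherwise any in \<open>S x\<close>.\<close>
  moreover have "take e ` W = coords is ` take n ` X"
  proof (intro equalityI subsetI)
    fix x' assume "x' \<in> take e ` W"
    then obtain x y where "length x = n" "x @ y \<in> X" "coords is x = x'"
      by (auto simp: W_def R_def)
    then have "x = take n (x @ y)" by simp
    then show "x' \<in> coords is ` take n ` X" using \<open>x @ y \<in> X\<close> \<open>coords is x = x'\<close> by blast
  next
    fix x' assume "x' \<in> coords is ` take n ` X"
    then obtain xy where xy: "xy \<in> X" "x' = coords is (take n xy)" by blast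
    define x where "x = take n xy"
    define y where "y = drop n xy"
    have x: "length x = n" "length y = n" "x @ y \<in> X"
      using xy(1) lenX[OF xy(1)] by (auto simp: x_def y_def)
    obtain w where w: "length w = e" "T x w \<longrightarrow> (\<forall>w. length w = e \<longrightarrow> T x w) \<and> S x w"
    proof (cases "\<forall>w. length w = e \<longrightarrow> T x w")
      case True
      have "S x (coords is y)" using x by (auto simp: S_def)
      then show thesis using that[of "coords is y"] True "is"(1) by simp
    next
      case False
      then show thesis using that by blast
    qed
    have "x' @ w \<in> W"
      using x w xy(2) "is"(1) by (auto simp: W_def R_def x_def[symmetric])
    moreover have "take e (x' @ w) = x'" using xy(2) "is"(1) by simp
    ultimately show "x' \<in> take e ` W" by (metis imageI)
  qed
  ultimately obtain c' where c': "length c' = e" "c' @ map \<delta> c' \<in> W"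
    using gen "is"(3) unfolding generic_scheme_def by metis
  then obtain c y0 where c: "length c = n" "length y0 = n" "c @ y0 \<in> X" "coords is c = c'"
    and TS: "T c (map \<delta> c') \<longrightarrow> (\<forall>w. length w = e \<longrightarrow> T c w) \<and> S c (map \<delta> c')"
    by (auto simp: W_def R_def)
  have \<delta>_coords: "coords is (map \<delta> c) = map \<delta> c'"
    using c(1,4) "is"(2) by (auto simp: coords_def subset_iff)
  have "take n (c @ y0) \<in> take n ` X" using c(3) by blast
  then have "c \<in> take n ` X" using c(1) by simp
  then have Reg: "c \<in> Reg j M U n ps" using X(3) by blast
  then have "map \<delta> c \<in> tau_at \<delta> n ps c"
    using ps by (intro derivation_in_tau_at[OF der]) (auto simp: Reg_def)
  note \<delta>c = this
  \<comment> \<open>As \<open>\<delta> c\<close> itself is a witness for \<open>T\<close>, the image \<open>T c\<close> is everything.\<close>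
  have "T c (map \<delta> c')" using \<delta>c c(1) \<delta>_coords unfolding T_def by (intro exI[of _ "map \<delta> c"]) simp
  then have T: "\<And>w. length w = e \<Longrightarrow> T c w" and "S c (map \<delta> c')" using TS by auto
  then obtain y where y: "length y = n" "c @ y \<in> X" "coords is y = map \<delta> c'"
    by (auto simp: S_def)
  have "y \<in> tau_at \<delta> n ps c"
    using X(2) y(1,2) c(1) by (auto simp: tau_def zeros_def)
  then have v: "map (\<lambda>i. y ! i - map \<delta> c ! i) [0..<n] \<in> tau_at (\<lambda>_. 0) n ps c"
    using \<delta>c by (rule tau_at_diff)
  obtain d' where d': "has_dim j M U n (tau_at (\<lambda>_. 0) n ps c) d'" "has_dim j M U n (zeros n ps) d'"
    using Reg by (auto simp: Reg_def)
  \<comment> \<open>Regularity speaks of some dimension of the zero set, possibly computed with other parameters.\<close>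
  have "d' \<le> e"
  proof -
    obtain js where js: "length js = d'" "set js \<subseteq> {..<n}" "large j M U d' (coords js ` zeros n ps)"
      using has_dim_projection[OF d'(2)] by blast
    show ?thesis using has_dim_ge[OF _ js(2) order_refl e(2)] js(1,3) by simp
  qed
  have "y ! k = map \<delta> c ! k" if "k < n" for k
  proof -
    have "map (\<lambda>i. y ! i - map \<delta> c ! i) [0..<n] ! k = 0"
    proof (rule tangent_projection_inj[OF "is"(2) d'(1) _ _ v _ that])
      show "d' \<le> length is" using \<open>d' \<le> e\<close> "is"(1) by simp
      fix w :: "'m list" assume w: "length w = length is"
      \<comment> \<open>The affine space is onto, hence so is its translate by \<open>- \<delta> c\<close>, the linear one.\<close>
      have "length (map2 (+) w (map \<delta> c')) = e" using w "is"(1) c'(1) by simp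
      then obtain y1 where y1: "length y1 = n" "y1 \<in> tau_at \<delta> n ps c"
        "coords is y1 = map2 (+) w (map \<delta> c')"
        using T unfolding T_def by blast
      have "coords is (map (\<lambda>i. y1 ! i - map \<delta> c ! i) [0..<n]) = w"
      proof (rule nth_equalityI)
        fix i assume "i < length (coords is (map (\<lambda>i. y1 ! i - map \<delta> c ! i) [0..<n]))"
        then have i: "i < length is" "is ! i < n" using "is"(2) by (auto simp: subset_iff)
        have "y1 ! (is ! i) = w ! i + map \<delta> c' ! i"
          using arg_cong[OF y1(3), of "\<lambda>xs. xs ! i"] i w c'(1) "is"(1) by (simp add: coords_def)
        moreover have "map \<delta> c ! (is ! i) = map \<delta> c' ! i"
          using arg_cong[OF \<delta>_coords, of "\<lambda>xs. xs ! i"] i by (simp add: coords_def)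
        ultimately show "coords is (map (\<lambda>i. y1 ! i - map \<delta> c ! i) [0..<n]) ! i = w ! i"
          using i c(1) by (simp add: coords_def)
      qed (use w in simp)
      then show "\<exists>v\<in>tau_at (\<lambda>_. 0) n ps c. coords is v = w"
        using tau_at_diff[OF y1(2) \<delta>c] by blast
    next
      fix i assume i: "i \<in> set is"
      then have "y ! i = map \<delta> c ! i"
        using y(3) \<delta>_coords by (simp add: coords_def flip: \<delta>_coords)
      then show "map (\<lambda>i. y ! i - map \<delta> c ! i) [0..<n] ! i = 0"
        using i "is"(2) by (auto simp: subset_iff)
    qed
    then show ?thesis using that by simp
  qed
  then have "y = map \<delta> c" using y(1) c(1) by (intro nth_equalityI) auto
  then show "\<exists>cs. length cs = n \<and> cs @ map \<delta> cs \<in> X" using y(2) c(1) by blast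
qed

end

theorem theorem7p7:
  fixes K :: "('f::arity, 'r::arity, 'k::field_char_0) struc"
    and \<eta> :: "'k \<Rightarrow> 'k"
    and M :: "('f, 'r, 'm::field_char_0) struc"
    and \<delta> :: "'m \<Rightarrow> 'm"
    and U :: "('f, 'r, 'u::field_char_0) struc"
    and j :: "'m \<Rightarrow> 'u"
  assumes "alg_bounded K (dcl0 K)"
    and "derivation_on (dcl0 K) \<eta>"
    and "monster j M U"
  shows "model_T_delta_PP K \<eta> j M U \<delta> \<longleftrightarrow> model_T_delta_g K \<eta> j M U \<delta>"
proof (cases "model_T_delta K \<eta> M \<delta>")
  case True
  then have "models M (Th K)" and der: "derivation_on UNIV \<delta>"
    by (simp_all add: model_T_delta_def)
  then interpret alg_bounded_monster K "dcl0 K" M U j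
    using assms(1,3) by unfold_locales
  show ?thesis
    using PP_imp_generic generic_imp_PP[OF der] True
    by (auto simp: model_T_delta_PP_def model_T_delta_g_def)
next
  case False
  then show ?thesis by (simp add: model_T_delta_PP_def model_T_delta_g_def)
qed

end
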